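(* Let $X$ be a $\frac{1}{3}$-homogeneous non-smooth fan with top $t$. Then: \begin{enumerate} \item $X$ is colocally connected at each point of $E(X)$; \item $E(X)$ is dense in $X$; and \item $S(X) = E(X) \cup \{t\}$. \end{enumerate}
   Context: All spaces are metric. A continuum is a compact connected metric space. A dendroid is an arcwise connected and hereditarily unicoherent continuum. In a dendroid $X$, for points $p,q \in X$, $pq$ denotes the unique arc in $X$ with endpoints $p$ and $q$ (with $pp=\{p\}$). A point $p$ of a dendroid $X$ has order $r$ (in the classical sense) if $p$ is a common endpoint of exactly $r$ arcs in $X$ which are disjoint from one another beyond $p$; $p$ is an endpoint if its order is $1$ and a ramification point if its order is greater than $2$ (possibly infinite). $E(X)$ denotes the set of endpoints of $X$. A fan is a dendroid with exactly one ramification point, called its top. A dendroid $X$ is smooth if there is a point $p \in X$ such that for each sequence $\{a_n\}_n$ of points of $X$ converging to a point $a \in X$, the arcs $pa_n$ converge to the arc $pa$ in the Hausdorff metric (in a smooth fan the top can always be used as $p$); non-smooth means not smooth. For a fan $X$ with top $t$ and $a \in X$, $X$ is smooth at $t$ with respect to $a$ if for every sequence $\{a_n\}_n$ in $X$ converging to $a$, $ta_n \to ta$ in the Hausdorff metric; $S(X) = \{a \in X : X \text{ is smooth at } t \text{ with respect to } a\}$. A space $X$ is $\frac{1}{n}$-homogeneous if the action of the group of homeomorphisms of $X$ onto itself on $X$ has exactly $n$ orbits. A space $X$ is colocally connected at a point $p \in X$ if each neighborhood of $p$ contains a neighborhood $V$ of $p$ such that $X - V$ is connected. *)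

theory Defs
  imports "HOL-Analysis.Analysis" "HOL-Library.Extended_Nat"
begin

(* Spaces are subsets X of an ambient metric space type, with the induced metric. *)

definition continuum :: "'a::metric_space set \<Rightarrow> bool" where
  "continuum X \<longleftrightarrow> compact X \<and> connected X"

definition arc_between :: "'a::metric_space set \<Rightarrow> 'a \<Rightarrow> 'a \<Rightarrow> bool" where
  "arc_between A p q \<longleftrightarrow>
     (\<exists>g. arc g \<and> path_image g = A \<and> pathstart g = p \<and> pathfinish g = q)"

definition arcwise_connected :: "'a::metric_space set \<Rightarrow> bool" where
  "arcwise_connected X \<longleftrightarrow>
     (\<forall>p\<in>X. \<forall>q\<in>X. p \<noteq> q \<longrightarrow> (\<exists>A\<subseteq>X. arc_between A p q))"

(* In a compact Y the connected closed subsets are exactly the subcontinua of Y. *)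
definition hereditarily_unicoherent :: "'a::metric_space set \<Rightarrow> bool" where
  "hereditarily_unicoherent X \<longleftrightarrow> (\<forall>Y\<subseteq>X. continuum Y \<longrightarrow> unicoherent Y)"

definition dendroid :: "'a::metric_space set \<Rightarrow> bool" where
  "dendroid X \<longleftrightarrow> continuum X \<and> arcwise_connected X \<and> hereditarily_unicoherent X"

(* The arc pq, including the convention pp = {p}. In a dendroid, for distinct p and q in X,
   the arc described by THE exists by arcwise connectedness and is unique by hereditary
   unicoherence. *)
definition arc_in :: "'a::metric_space set \<Rightarrow> 'a \<Rightarrow> 'a \<Rightarrow> 'a set" where
  "arc_in X p q = (if p = q then {p} else (THE A. A \<subseteq> X \<and> arc_between A p q))"

(* The classical order of p is the largest number of arcs in X that emanate from p and are
   disjoint from one another beyond p. All infinite orders are identified, which is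
   immaterial for the distinction between order 1 and order greater than 2. *)
definition point_order :: "'a::metric_space set \<Rightarrow> 'a \<Rightarrow> enat" where
  "point_order X p =
     Sup {enat (card F) | F. finite F \<and>
            (\<forall>A\<in>F. A \<subseteq> X \<and> (\<exists>q. arc_between A p q)) \<and>
            pairwise (\<lambda>A B. A \<inter> B = {p}) F}"

definition endpoints :: "'a::metric_space set \<Rightarrow> 'a set" where
  "endpoints X = {p \<in> X. point_order X p = 1}"

definition ramification_points :: "'a::metric_space set \<Rightarrow> 'a set" where
  "ramification_points X = {p \<in> X. point_order X p > 2}"

definition fan_with_top :: "'a::metric_space set \<Rightarrow> 'a \<Rightarrow> bool" where
  "fan_with_top X t \<longleftrightarrow> dendroid X \<and> ramification_points X = {t}"

(* The Hausdorff metric; meaningful for nonempty bounded closed A and B. *)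
definition hausdorff_dist :: "'a::metric_space set \<Rightarrow> 'a set \<Rightarrow> real" where
  "hausdorff_dist A B = max (SUP a\<in>A. infdist a B) (SUP b\<in>B. infdist b A)"

definition smooth_wrt :: "'a::metric_space set \<Rightarrow> 'a \<Rightarrow> 'a \<Rightarrow> bool" where
  "smooth_wrt X p a \<longleftrightarrow>
     (\<forall>s :: nat \<Rightarrow> 'a. (\<forall>n. s n \<in> X) \<and> s \<longlonglongrightarrow> a \<longrightarrow>
        (\<lambda>n. hausdorff_dist (arc_in X p (s n)) (arc_in X p a)) \<longlonglongrightarrow> 0)"

definition smooth :: "'a::metric_space set \<Rightarrow> bool" where
  "smooth X \<longleftrightarrow> (\<exists>p\<in>X. \<forall>a\<in>X. smooth_wrt X p a)"

definition smooth_points :: "'a::metric_space set \<Rightarrow> 'a \<Rightarrow> 'a set" where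
  "smooth_points X t = {a \<in> X. smooth_wrt X t a}"

definition homeo_orbit :: "'a::metric_space set \<Rightarrow> 'a \<Rightarrow> 'a set" where
  "homeo_orbit X x = {h x | h. \<exists>g. homeomorphism X X h g}"

definition inv_n_homogeneous :: "nat \<Rightarrow> 'a::metric_space set \<Rightarrow> bool" where
  "inv_n_homogeneous n X \<longleftrightarrow>
     finite (homeo_orbit X ` X) \<and> card (homeo_orbit X ` X) = n"

(* Neighborhoods are relative to X and need not be open. *)
definition nbhd_in :: "'a::metric_space set \<Rightarrow> 'a \<Rightarrow> 'a set \<Rightarrow> bool" where
  "nbhd_in X p U \<longleftrightarrow>
     U \<subseteq> X \<and> (\<exists>W. openin (top_of_set X) W \<and> p \<in> W \<and> W \<subseteq> U)"

definition colocally_connected_at :: "'a::metric_space set \<Rightarrow> 'a \<Rightarrow> bool" where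
  "colocally_connected_at X p \<longleftrightarrow>
     (\<forall>U. nbhd_in X p U \<longrightarrow> (\<exists>V\<subseteq>U. nbhd_in X p V \<and> connected (X - V)))"

end

theory Submission
  imports Defs
begin

text \<open>For a point \<open>x\<close> of \<open>X\<close> write \<open>stem x\<close> for the arc from the top \<open>t\<close> to \<open>x\<close>; hereditary
unicoherence makes it the least subcontinuum containing \<open>t\<close> and \<open>x\<close>. The \<open>shadow\<close> of an open set
\<open>V\<close> consists of the points whose stem meets \<open>V\<close>. The complement of a shadow is a union of stems,
so it is connected, and its closure is a continuum that still misses \<open>V\<close>; by minimality of stems
the complement is already closed. Shadows are therefore open: stems depend lower semicontinuously
on their tip. The failure of upper semicontinuity is recorded by the \<open>cluster\<close> of \<open>y\<close>, the
intersection of the closures of the shadows of the neighbourhoods of \<open>y\<close>. It is the continuum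
of all \<open>a\<close> near which there are points whose stems pass arbitrarily close to \<open>y\<close>, so smoothness at
\<open>t\<close> with respect to \<open>a\<close> says that only the points of \<open>stem a\<close> have \<open>a\<close> in their cluster
(\<open>smooth_wrt_iff\<close>). A Baire category argument over a countable base shows that smoothness holds
on a dense set of points (\<open>exists_smooth_at\<close>).

The top, the endpoints and the remaining inner points are invariant sets, all nonempty; for
endpoints this needs that increasing sequences of stems are bounded
(\<open>increasing_stems_bounded\<close>). Hence three orbits means that homeomorphisms act transitively on
the endpoints and on the inner points. If the inner points were points of smoothness, then so
would be the top and the endpoints (\<open>smooth_if_inner_smooth\<close>), and \<open>X\<close> would be smooth. So no
inner point is one; the dense set of points of smoothness then contains an endpoint,
hence all of them, and the endpoints are dense.

The heart of the proof is that the cluster of an endpoint \<open>e\<close> is \<open>{e}\<close>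
(\<open>cluster_endpoint\<close>). Otherwise this continuum contains a terminal piece of \<open>stem e\<close>, thus an inner point,
and by homogeneity every inner point lies in the cluster of the endpoint above it. Arms
passing close to an endpoint then return close to every point of its stem, in particular close to
the top. Since endpoints are dense, this can be iterated on a nested sequence of open sets, and a
point in all of them has a stem that oscillates infinitely often between two separated sets, which an arc cannot do
(\<open>no_return\<close>).

Small neighbourhoods of \<open>e\<close> therefore have small shadows, whose complements are connected: this is
colocal connectedness. If \<open>t\<close> were not a point of smoothness, it would lie in the
cluster of another point, necessarily inner, hence in the clusters of all inner points, and, by
passing to the limit, in the cluster of an endpoint, which is impossible (\<open>root_smooth\<close>).\<close>

section \<open>Metric and hyperspace preliminaries\<close>

lemma connected_islimpt:
  fixes S :: "'a::metric_space set"
  assumes "connected S" "a \<in> S" "b \<in> S" "a \<noteq> b"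
  shows "a islimpt S"
proof (rule connected_imp_perfect[OF assms(1,2)])
  show "S \<noteq> {x}" for x using assms(2-4) by auto
qed

lemma Baire_compact:
  fixes K :: "'a::metric_space set"
  assumes K: "compact K" and G: "countable \<G>"
    and T: "\<And>T. T \<in> \<G> \<Longrightarrow> closed T \<and> T \<subseteq> K"
    and nwd: "\<And>T W. T \<in> \<G> \<Longrightarrow> open W \<Longrightarrow> W \<inter> K \<noteq> {} \<Longrightarrow> \<not> W \<inter> K \<subseteq> T"
    and W: "open W" "W \<inter> K \<noteq> {}"
  obtains x where "x \<in> W" "x \<in> K" "x \<notin> \<Union>\<G>"
proof -
  have "compact_space (top_of_set K)"
    using K by (simp add: compact_space_subtopology)
  then have "locally_compact_space (top_of_set K)"
    using compact_imp_locally_compact_space by blast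
  moreover have "regular_space (top_of_set K)"
    by (simp add: regular_space_euclidean regular_space_subtopology)
  moreover have "closedin (top_of_set K) T \<and> top_of_set K interior_of T = {}" if "T \<in> \<G>" for T
  proof
    show "closedin (top_of_set K) T"
      using T[OF that] by (simp add: closed_subset)
    show "top_of_set K interior_of T = {}"
    proof (rule ccontr)
      assume ne: "top_of_set K interior_of T \<noteq> {}"
      have "openin (top_of_set K) (top_of_set K interior_of T)"
        by simp
      then obtain V where V: "open V" "top_of_set K interior_of T = K \<inter> V"
        by (rule openin_open[THEN iffD1, THEN exE]) blast
      then have "V \<inter> K \<noteq> {}" "V \<inter> K \<subseteq> T"
        using ne interior_of_subset[of "top_of_set K" T] by auto
      then show False
        using nwd[OF that V(1)] by simp
    qed
  qed
  ultimately have int: "top_of_set K interior_of \<Union>\<G> = {}"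
    using Baire_category_alt[OF _ G] by blast
  have "\<not> W \<inter> K \<subseteq> \<Union>\<G>"
  proof
    assume sub: "W \<inter> K \<subseteq> \<Union>\<G>"
    have "openin (top_of_set K) (W \<inter> K)"
      using W(1) openin_open_Int[of W K] by (simp add: Int_commute)
    then have "W \<inter> K \<subseteq> top_of_set K interior_of \<Union>\<G>"
      using sub by (simp add: interior_of_maximal)
    then show False
      using int W(2) by simp
  qed
  then show ?thesis using that by blast
qed

lemma compact_countable_base:
  fixes X :: "'a::metric_space set"
  assumes "compact X"
  obtains \<B> where "countable \<B>" "\<And>B. B \<in> \<B> \<Longrightarrow> open B"
    "\<And>y V. y \<in> X \<Longrightarrow> open V \<Longrightarrow> y \<in> V \<Longrightarrow> \<exists>B\<in>\<B>. y \<in> B \<and> B \<subseteq> V"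
proof -
  have "\<exists>F. finite F \<and> X \<subseteq> (\<Union>x\<in>F. ball x (1 / real (Suc n)))" for n
  proof -
    have "X \<subseteq> (\<Union>x\<in>X. ball x (1 / real (Suc n)))"
      by fastforce
    then obtain D where "D \<subseteq> X" "finite D" "X \<subseteq> (\<Union>x\<in>D. ball x (1 / real (Suc n)))"
      using compactE_image[OF assms, of X "\<lambda>x. ball x (1 / real (Suc n))"] by (metis open_ball)
    then show ?thesis by blast
  qed
  then obtain F where F: "\<And>n. finite (F n)" "\<And>n. X \<subseteq> (\<Union>x\<in>F n. ball x (1 / real (Suc n)))"
    by metis
  define \<B> where "\<B> = (\<Union>n. (\<lambda>x. ball x (1 / real (Suc n))) ` F n)"
  show ?thesis
  proof
    show "countable \<B>"
      unfolding \<B>_def by (intro countable_UN countable_image countable_finite F(1) countableI_type)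
    show "open B" if "B \<in> \<B>" for B
      using that unfolding \<B>_def by auto
    show "\<exists>B\<in>\<B>. y \<in> B \<and> B \<subseteq> V" if y: "y \<in> X" and V: "open V" "y \<in> V" for y V
    proof -
      obtain e where e: "e > 0" "ball y e \<subseteq> V"
        using V open_contains_ball by blast
      obtain n where n: "1 / real (Suc n) < e / 2"
        using nat_approx_posE[of "e / 2"] e(1) by auto
      obtain x where x: "x \<in> F n" "y \<in> ball x (1 / real (Suc n))"
        using F(2)[of n] y by blast
      have "ball x (1 / real (Suc n)) \<subseteq> ball y e"
      proof
        fix z assume "z \<in> ball x (1 / real (Suc n))"
        then have "dist y z < e"
          using x(2) n dist_triangle3[of y z x] by (simp add: dist_commute)
        then show "z \<in> ball y e" by simp
      qed
      then show ?thesis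
        using e(2) x unfolding \<B>_def by blast
    qed
  qed
qed

lemma bdd_above_infdist_compact:
  fixes A :: "'a::metric_space set"
  assumes "compact A"
  shows "bdd_above ((\<lambda>a. infdist a B) ` A)"
proof -
  have "compact ((\<lambda>a. infdist a B) ` A)"
    using assms by (intro compact_continuous_image continuous_on_infdist continuous_on_id)
  then show ?thesis
    by (intro bounded_imp_bdd_above compact_imp_bounded)
qed

lemma infdist_le_hausdorff_dist:
  fixes A :: "'a::metric_space set"
  assumes "compact A" "a \<in> A"
  shows "infdist a B \<le> hausdorff_dist A B"
  unfolding hausdorff_dist_def
  using cSUP_upper[OF assms(2) bdd_above_infdist_compact[OF assms(1)], of B] by (rule max.coboundedI1)

lemma hausdorff_dist_leI:
  fixes A :: "'a::metric_space set"
  assumes "A \<noteq> {}" "B \<noteq> {}" "\<And>a. a \<in> A \<Longrightarrow> infdist a B \<le> e" "\<And>b. b \<in> B \<Longrightarrow> infdist b A \<le> e"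
  shows "hausdorff_dist A B \<le> e"
  unfolding hausdorff_dist_def using assms by (intro max.boundedI cSUP_least)

section \<open>Arcs and subcontinua of a dendroid\<close>

lemma continuum_Un:
  fixes C D :: "'a::metric_space set"
  assumes "continuum C" "continuum D" "C \<inter> D \<noteq> {}"
  shows "continuum (C \<union> D)"
  using assms unfolding continuum_def by (simp add: compact_Un connected_Un)

text \<open>Two intersecting subcontinua have a union that is again a subcontinuum, and unicoherence of this
union is the claim.\<close>

lemma dendroid_continuum_Int_connected:
  fixes X :: "'a::metric_space set"
  assumes X: "dendroid X" and C: "continuum C" "C \<subseteq> X" and D: "continuum D" "D \<subseteq> X"
  shows "connected (C \<inter> D)"
proof (cases "C \<inter> D = {}")
  case True
  then show ?thesis by simp
next
  case False
  then have "continuum (C \<union> D)"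
    by (rule continuum_Un[OF C(1) D(1)])
  then have u: "unicoherent (C \<union> D)"
    using X C D unfolding dendroid_def hereditarily_unicoherent_def by simp
  have cl: "closed C" "closed D" and co: "connected C" "connected D"
    using C D by (auto simp: continuum_def compact_imp_closed)
  then have "closedin (top_of_set (C \<union> D)) C" "closedin (top_of_set (C \<union> D)) D"
    by (auto intro: closed_subset)
  then show ?thesis
    by (rule u[unfolded unicoherent_def, rule_format, OF conjI, OF co(1) conjI, OF co(2) conjI,
          OF refl conjI])
qed

lemma continuum_arc_between:
  fixes A :: "'a::metric_space set"
  assumes "arc_between A p q"
  shows "continuum A" "p \<in> A" "q \<in> A" "p \<noteq> q"
proof -
  obtain g where g: "arc g" "path_image g = A" "pathstart g = p" "pathfinish g = q"
    using assms unfolding arc_between_def by blast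
  show "continuum A"
    using g(1,2) compact_arc_image connected_arc_image unfolding continuum_def by blast
  show "p \<in> A" "q \<in> A"
    using g(2-4) by auto
  show "p \<noteq> q"
    using arc_distinct_ends[OF g(1)] g(3,4) by simp
qed

lemma arc_between_sym:
  assumes "arc_between A p q"
  shows "arc_between A q p"
proof -
  obtain g where "arc g" "path_image g = A" "pathstart g = p" "pathfinish g = q"
    using assms unfolding arc_between_def by blast
  then have "arc (reversepath g) \<and> path_image (reversepath g) = A
      \<and> pathstart (reversepath g) = q \<and> pathfinish (reversepath g) = p"
    by (simp add: arc_reversepath)
  then show ?thesis
    unfolding arc_between_def by blast
qed

lemma arc_between_subinterval:
  fixes g :: "real \<Rightarrow> 'a::metric_space"
  assumes g: "arc g" and uv: "0 \<le> u" "u < v" "v \<le> 1"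
  shows "arc_between (g ` {u..v}) (g u) (g v)"
proof -
  define k where "k = (\<lambda>r. u + (v - u) * r)"
  have k: "k ` {0..1} = {u..v}"
  proof -
    have "(\<lambda>r. (v - u) * r + u) ` {0..1} = {u..v}"
      using uv by (subst image_affinity_atLeastAtMost) simp
    then show ?thesis by (simp add: k_def add.commute)
  qed
  have sub: "k ` {0..1} \<subseteq> {0..1}"
    using k uv by simp
  have "continuous_on {0..1} (g \<circ> k)"
    using g sub unfolding arc_def path_def k_def
    by (intro continuous_on_compose continuous_intros) (auto elim: continuous_on_subset)
  moreover have "inj_on k {0..1}"
    using uv by (auto simp: inj_on_def k_def)
  then have "inj_on (g \<circ> k) {0..1}"
    using g sub by (auto simp: arc_def intro: comp_inj_on inj_on_subset)
  ultimately have "arc (g \<circ> k)"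
    by (simp add: arc_def path_def)
  moreover have "path_image (g \<circ> k) = g ` {u..v}"
    unfolding path_image_def image_comp[symmetric] k ..
  moreover have "pathstart (g \<circ> k) = g u" "pathfinish (g \<circ> k) = g v"
    by (simp_all add: pathstart_def pathfinish_def k_def)
  ultimately show ?thesis
    unfolding arc_between_def by blast
qed

lemma arc_between_image:
  fixes A :: "'a::metric_space set" and h :: "'a \<Rightarrow> 'b::metric_space"
  assumes A: "arc_between A p q" and h: "continuous_on A h" "inj_on h A"
  shows "arc_between (h ` A) (h p) (h q)"
proof -
  obtain g where g: "arc g" "path_image g = A" "pathstart g = p" "pathfinish g = q"
    using A unfolding arc_between_def by blast
  have im: "g ` {0..1} = A" using g(2) by (simp add: path_image_def)
  have "continuous_on {0..1} (h \<circ> g)" "inj_on (h \<circ> g) {0..1}"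
    using g(1) h unfolding arc_def path_def im[symmetric]
    by (blast intro: continuous_on_compose, blast intro: comp_inj_on)
  then have "arc (h \<circ> g)"
    by (simp add: arc_def path_def)
  moreover have "path_image (h \<circ> g) = h ` A" "pathstart (h \<circ> g) = h p" "pathfinish (h \<circ> g) = h q"
    using g by (auto simp: path_image_def pathstart_def pathfinish_def)
  ultimately show ?thesis unfolding arc_between_def by blast
qed

text \<open>By \<open>dendroid_continuum_Int_connected\<close>, \<open>C\<close> meets the arc \<open>A\<close> in a connected set containing both ends of \<open>A\<close>,
while removing any point from between them disconnects \<open>A\<close>. This gives uniqueness of arcs, and
it is the form in which unicoherence enters most of the arguments below.\<close>

lemma dendroid_arc_least:
  fixes X :: "'a::metric_space set"
  assumes X: "dendroid X" and A: "arc_between A p q" "A \<subseteq> X"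
    and C: "continuum C" "C \<subseteq> X" "p \<in> C" "q \<in> C"
  shows "A \<subseteq> C"
proof
  fix a assume "a \<in> A"
  obtain g where g: "arc g" "path_image g = A" "g 0 = p" "g 1 = q"
    using A unfolding arc_between_def pathstart_def pathfinish_def by blast
  have cont: "continuous_on {0..1} g" and inj: "inj_on g {0..1}"
    using g(1) by (auto simp: arc_def path_def)
  obtain s where s: "s \<in> {0..1}" "a = g s"
    using \<open>a \<in> A\<close> g(2) by (auto simp: path_image_def)
  have conn: "connected (C \<inter> A)"
    using dendroid_continuum_Int_connected[OF X C(1,2) continuum_arc_between(1)[OF A(1)] A(2)] .
  have clo: "closed (g ` {0..s})" "closed (g ` {s..1})"
    using s(1) by (intro compact_imp_closed compact_continuous_image
        continuous_on_subset[OF cont] compact_Icc, force)+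
  show "a \<in> C"
  proof (rule ccontr)
    assume "a \<notin> C"
    have "g r1 = a" if "g r1 = g r2" "r1 \<in> {0..s}" "r2 \<in> {s..1}" for r1 r2
    proof -
      have "r1 = r2"
        using inj_onD[OF inj that(1)] that s(1) by simp
      then have "r1 = s" using that by simp
      then show ?thesis using s(2) by simp
    qed
    then have "g ` {0..s} \<inter> g ` {s..1} \<subseteq> {a}"
      by blast
    then have "g ` {0..s} \<inter> g ` {s..1} \<inter> (C \<inter> A) = {}"
      using \<open>a \<notin> C\<close> by blast
    moreover have "{0..1} \<subseteq> {0..s} \<union> {s..1}" by auto
    then have "C \<inter> A \<subseteq> g ` {0..s} \<union> g ` {s..1}"
      using g(2) unfolding path_image_def by blast
    moreover have "g 0 \<in> g ` {0..s}" "g 1 \<in> g ` {s..1}"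
      using s(1) by simp_all
    then have "g ` {0..s} \<inter> (C \<inter> A) \<noteq> {}" "g ` {s..1} \<inter> (C \<inter> A) \<noteq> {}"
      using C(3,4) g(3,4) continuum_arc_between(2,3)[OF A(1)] by auto
    ultimately show False
      using connected_closedD[OF conn _ _ clo] by metis
  qed
qed

lemma arc_in_eqI:
  fixes X :: "'a::metric_space set"
  assumes X: "dendroid X" and A: "arc_between A p q" "A \<subseteq> X"
  shows "arc_in X p q = A"
proof -
  have uniq: "B = A" if "B \<subseteq> X" "arc_between B p q" for B
    using dendroid_arc_least[OF X A continuum_arc_between(1)[OF that(2)] that(1)]
      dendroid_arc_least[OF X that(2,1) continuum_arc_between(1)[OF A(1)] A(2)]
      continuum_arc_between(2,3)[OF A(1)] continuum_arc_between(2,3)[OF that(2)] by simp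
  have "(THE A. A \<subseteq> X \<and> arc_between A p q) = A"
    by (rule the_equality) (use A in simp, erule conjE, rule uniq)
  then show ?thesis
    using continuum_arc_between(4)[OF A(1)] by (simp add: arc_in_def)
qed

section \<open>The order of a point\<close>

lemma card_le_point_order:
  assumes "finite F" "\<And>A. A \<in> F \<Longrightarrow> A \<subseteq> X \<and> (\<exists>q. arc_between A p q)"
    "pairwise (\<lambda>A B. A \<inter> B = {p}) F"
  shows "enat (card F) \<le> point_order X p"
  unfolding point_order_def using assms by (intro Sup_upper) blast

lemma point_order_le_image:
  fixes X :: "'a::metric_space set"
  assumes h: "homeomorphism X X h k" and p: "p \<in> X"
  shows "point_order X p \<le> point_order X (h p)"
  unfolding point_order_def[of X p]
proof (rule Sup_least, safe)
  fix F :: "'a set set"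
  assume F: "finite F" "\<forall>A\<in>F. A \<subseteq> X \<and> (\<exists>q. arc_between A p q)" "pairwise (\<lambda>A B. A \<inter> B = {p}) F"
  have cont: "continuous_on X h" using h by (simp add: homeomorphism_def)
  have inj: "inj_on h X" using homeomorphism_apply1[OF h] by (metis inj_on_inverseI)
  have "\<Union>F \<subseteq> X" using F(2) by blast
  then have "inj_on ((`) h) F"
    by (intro inj_on_image inj_on_subset[OF inj])
  then have "card F = card ((`) h ` F)" by (simp add: card_image)
  moreover have "enat (card ((`) h ` F)) \<le> point_order X (h p)"
  proof (rule card_le_point_order)
    show "finite ((`) h ` F)" using F(1) by simp
    show "B \<subseteq> X \<and> (\<exists>q. arc_between B (h p) q)" if "B \<in> (`) h ` F" for B
    proof -
      obtain A where A: "A \<in> F" "B = h ` A" using \<open>B \<in> (`) h ` F\<close> by blast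
      have AX: "A \<subseteq> X" "\<exists>q. arc_between A p q" using bspec[OF F(2) A(1)] by simp_all
      obtain q where q: "arc_between A p q" using AX(2) by (rule exE)
      have "arc_between B (h p) (h q)"
        unfolding A(2) by (rule arc_between_image[OF q continuous_on_subset[OF cont AX(1)]
            inj_on_subset[OF inj AX(1)]])
      moreover have "B \<subseteq> X"
        using AX(1) homeomorphism_image1[OF h] A(2) by blast
      ultimately show ?thesis by blast
    qed
    show "pairwise (\<lambda>A B. A \<inter> B = {h p}) ((`) h ` F)"
    proof (rule pairwiseI)
      fix B1 B2 assume B: "B1 \<in> (`) h ` F" "B2 \<in> (`) h ` F" "B1 \<noteq> B2"
      then obtain A1 A2 where A: "A1 \<in> F" "A2 \<in> F" "B1 = h ` A1" "B2 = h ` A2" by blast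
      then have "A1 \<inter> A2 = {p}" using F(3) B(3) unfolding pairwise_def by blast
      moreover have "h ` (A1 \<inter> A2) = h ` A1 \<inter> h ` A2"
        using inj_on_image_Int[OF inj] F(2) A by blast
      ultimately show "B1 \<inter> B2 = {h p}" using A by simp
    qed
  qed
  ultimately show "enat (card F) \<le> point_order X (h p)" by simp
qed

lemma point_order_homeomorphism:
  fixes X :: "'a::metric_space set"
  assumes h: "homeomorphism X X h k" and p: "p \<in> X"
  shows "point_order X (h p) = point_order X p"
proof (rule antisym)
  have "h p \<in> X" using homeomorphism_image1[OF h] p by blast
  then show "point_order X (h p) \<le> point_order X p"
    using point_order_le_image[OF homeomorphism_symD[OF h], of "h p"] homeomorphism_apply1[OF h p]
    by simp
qed (rule point_order_le_image[OF h p])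

section \<open>Stems of a rooted dendroid\<close>

locale rooted_dendroid =
  fixes X :: "'a::metric_space set" and t :: 'a
  assumes dendroid: "dendroid X" and root: "t \<in> X"

begin

abbreviation stem :: "'a \<Rightarrow> 'a set" where
  "stem x \<equiv> arc_in X t x"

lemma compact_X: "compact X" and connected_X: "connected X" and closed_X: "closed X"
  using dendroid by (auto simp: dendroid_def continuum_def compact_imp_closed)

lemma stem_root [simp]: "stem t = {t}"
  by (simp add: arc_in_def)

lemma arc_between_stem:
  assumes "x \<in> X" "x \<noteq> t"
  shows "arc_between (stem x) t x" "stem x \<subseteq> X"
proof -
  obtain A where "A \<subseteq> X" "arc_between A t x"
    using dendroid assms root unfolding dendroid_def arcwise_connected_def by metis
  then show "arc_between (stem x) t x" "stem x \<subseteq> X"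
    using arc_in_eqI[OF dendroid] by metis+
qed

lemma stem_subset: "x \<in> X \<Longrightarrow> stem x \<subseteq> X"
  using arc_between_stem(2) root stem_root by (cases "x = t") simp_all

lemma stem_continuum: "x \<in> X \<Longrightarrow> continuum (stem x)"
  using arc_between_stem(1) continuum_arc_between(1) continuum_def stem_root
  by (metis compact_sing connected_sing)

lemma stem_ends: "x \<in> X \<Longrightarrow> t \<in> stem x" "x \<in> X \<Longrightarrow> x \<in> stem x"
  using arc_between_stem(1) continuum_arc_between(2,3) stem_root by (metis singletonI)+

lemma compact_stem: "x \<in> X \<Longrightarrow> compact (stem x)"
  and connected_stem: "x \<in> X \<Longrightarrow> connected (stem x)"
  and closed_stem: "x \<in> X \<Longrightarrow> closed (stem x)"
  using stem_continuum by (simp_all add: continuum_def compact_imp_closed)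

lemma stem_least:
  assumes "x \<in> X" "continuum C" "C \<subseteq> X" "t \<in> C" "x \<in> C"
  shows "stem x \<subseteq> C"
proof (cases "x = t")
  case False
  then show ?thesis
    using dendroid_arc_least[OF dendroid arc_between_stem[OF assms(1) False]] assms by blast
qed (use assms in auto)

lemma stem_mono: "x \<in> X \<Longrightarrow> y \<in> stem x \<Longrightarrow> stem y \<subseteq> stem x"
  using stem_least[of y "stem x"] stem_subset[of x] stem_continuum[of x] stem_ends(1)[of x]
  by (simp add: subset_iff)

lemma stem_trans: "x \<in> X \<Longrightarrow> y \<in> stem x \<Longrightarrow> z \<in> stem y \<Longrightarrow> z \<in> stem x"
  using stem_mono by blast

text \<open>Along the parametrization the relation \<open>y \<in> stem x\<close> becomes the order of the unit interval. It is
the partial order used throughout: \<open>y \<in> stem x\<close> reads ``\<open>y\<close> lies below \<open>x\<close>''.\<close>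

lemma stem_parametrization:
  assumes x: "x \<in> X" "x \<noteq> t"
  obtains g where "arc g" "g ` {0..1} = stem x" "g 0 = t" "g 1 = x"
    "\<And>s. s \<in> {0..1} \<Longrightarrow> stem (g s) = g ` {0..s}"
proof -
  obtain g where g: "arc g" "path_image g = stem x" "g 0 = t" "g 1 = x"
    using arc_between_stem[OF x] unfolding arc_between_def pathstart_def pathfinish_def by blast
  have "stem (g s) = g ` {0..s}" if s: "s \<in> {0..1}" for s
  proof (cases "s = 0")
    case False
    have "arc_between (g ` {0..s}) t (g s)"
      using arc_between_subinterval[OF g(1), of 0 s] s False g(3) by simp
    moreover have "g ` {0..s} \<subseteq> X"
      using g(2) stem_subset[OF x(1)] s by (fastforce simp: path_image_def)
    ultimately show ?thesis
      by (rule arc_in_eqI[OF dendroid])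
  qed (simp add: g)
  with g that show ?thesis by (auto simp: path_image_def)
qed

lemma stem_antisym:
  assumes "x \<in> X" "y \<in> stem x" "x \<in> stem y"
  shows "x = y"
proof (cases "x = t")
  case True
  then show ?thesis using assms by simp
next
  case False
  obtain g where g: "arc g" "g ` {0..1} = stem x" "g 0 = t" "g 1 = x"
    "\<And>s. s \<in> {0..1} \<Longrightarrow> stem (g s) = g ` {0..s}"
    using stem_parametrization[OF assms(1) False] by metis
  obtain s where s: "s \<in> {0..1}" "y = g s"
    using assms(2) g(2) by (metis imageE)
  then obtain r where "r \<in> {0..s}" "g r = g 1"
    using assms(3) g(4,5) by (metis imageE)
  then have "r = 1"
    using g(1) s by (auto simp: arc_def inj_on_def)
  then show ?thesis using s \<open>r \<in> {0..s}\<close> g(4) by auto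
qed

lemma stem_linear:
  assumes "x \<in> X" "p \<in> stem x" "q \<in> stem x"
  shows "p \<in> stem q \<or> q \<in> stem p"
proof (cases "x = t")
  case False
  obtain g where g: "g ` {0..1} = stem x"
    and g': "\<And>s::real. s \<in> {0..1} \<Longrightarrow> stem (g s) = g ` {0..s}"
    by (rule stem_parametrization[OF assms(1) False]) blast
  obtain r s where "r \<in> {0..1}" "p = g r" "s \<in> {0..1}" "q = g s"
    using assms(2,3) g(1) by (metis imageE)
  then show ?thesis
    using g' by (cases "r \<le> s") auto
next
  case True
  then show ?thesis using assms by simp
qed

lemma upper_stem_image:
  assumes "arc g" "g ` {0..1} = stem x" 
    "\<And>s. s \<in> {0..1} \<Longrightarrow> stem (g s) = g ` {0..s}" "s \<in> {0..1}"
  shows "{w \<in> stem x. g s \<in> stem w} = g ` {s..1}"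
proof -
  have inj: "inj_on g {0..1}" using assms(1) by (simp add: arc_def)
  have "g s \<in> g ` {0..r} \<longleftrightarrow> s \<le> r" if "r \<in> {0..1}" for r
    using inj_on_image_mem_iff[OF inj assms(4), of "{0..r}"] assms(4) that by simp
  then have "{w \<in> g ` {0..1}. g s \<in> stem w} = g ` {r\<in>{0..1}. s \<le> r}"
    using assms(3) by auto
  also have "{r\<in>{0..1}. s \<le> r} = {s..1}" using assms(4) by auto
  finally show ?thesis using assms(2) by simp
qed

lemma arc_between_upper_stem:
  assumes x: "x \<in> X" and y: "y \<in> stem x" "y \<noteq> x"
  shows "arc_between {w \<in> stem x. y \<in> stem w} y x"
proof -
  have "x \<noteq> t" using y by auto
  then obtain g where g: "arc g" "g ` {0..1} = stem x" "g 0 = t" "g 1 = x"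
    "\<And>s. s \<in> {0..1} \<Longrightarrow> stem (g s) = g ` {0..s}"
    using stem_parametrization[OF x] by metis
  obtain s where s: "s \<in> {0..1}" "y = g s"
    using y(1) g(2) by (metis imageE)
  then have "s \<noteq> 1" using y(2) g(4) by auto
  have "arc_between (g ` {s..1}) y x"
    using arc_between_subinterval[OF g(1), of s 1] s \<open>s \<noteq> 1\<close> g(4) by simp
  then show ?thesis
    using upper_stem_image[OF g(1,2,5) s(1)] s(2) by simp
qed

lemma connected_upper_stem:
  assumes x: "x \<in> X" and y: "y \<in> stem x"
  shows "connected {w \<in> stem x. y \<in> stem w}"
proof (cases "y = x")
  case True
  then have "{w \<in> stem x. y \<in> stem w} \<subseteq> {x}"
    using stem_antisym[OF x] by blast
  then show ?thesis
    by (metis connected_empty connected_sing subset_singletonD)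
next
  case False
  then show ?thesis
    using continuum_arc_between(1)[OF arc_between_upper_stem[OF x y False]]
    by (simp add: continuum_def)
qed

text \<open>The points above \<open>x\<close> form a union of arcs emanating from \<open>x\<close>. The whole upset is needed because
shadows are unions of upsets.\<close>

lemma connected_upset: "connected {z \<in> X. x \<in> stem z}"
proof (cases "x \<in> X")
  case True
  have eq: "{z \<in> X. x \<in> stem z} = \<Union>((\<lambda>z. {w \<in> stem z. x \<in> stem w}) ` {z \<in> X. x \<in> stem z})"
    using stem_ends(2) stem_subset by blast
  have "connected (\<Union>((\<lambda>z. {w \<in> stem z. x \<in> stem w}) ` {z \<in> X. x \<in> stem z}))"
  proof (rule connected_Union)
    show "connected s" if "s \<in> (\<lambda>z. {w \<in> stem z. x \<in> stem w}) ` {z \<in> X. x \<in> stem z}" for s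
      using that connected_upper_stem by auto
    have "x \<in> \<Inter>((\<lambda>z. {w \<in> stem z. x \<in> stem w}) ` {z \<in> X. x \<in> stem z})"
      using stem_ends(2)[OF True] by blast
    then show "\<Inter>((\<lambda>z. {w \<in> stem z. x \<in> stem w}) ` {z \<in> X. x \<in> stem z}) \<noteq> {}" by blast
  qed
  then show ?thesis using eq by simp
next
  case False
  then have "{z \<in> X. x \<in> stem z} = {}"
    using stem_subset by blast
  then show ?thesis
    by (metis connected_empty)
qed

text \<open>\<open>stem p \<union> C\<close> is a continuum joining the root to \<open>x\<close>, so it contains \<open>stem x\<close>; a point above
\<open>p\<close> that is not in \<open>C\<close> would also be below \<open>p\<close>.\<close>

lemma upper_stem_least:
  assumes "x \<in> X" "p \<in> stem x" "continuum C" "C \<subseteq> X" "p \<in> C" "x \<in> C" "w \<in> stem x" "p \<in> stem w"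
  shows "w \<in> C"
proof -
  have pX: "p \<in> X" using assms stem_subset by blast
  have "continuum (stem p \<union> C)"
    using continuum_Un[OF stem_continuum[OF pX] assms(3)] assms(5) stem_ends(2)[OF pX] by auto
  then have "stem x \<subseteq> stem p \<union> C"
    using stem_least[of x "stem p \<union> C"] assms(1,4,6) stem_ends(1)[OF pX] stem_subset[OF pX] by simp
  then show ?thesis
    using assms(5,7,8) stem_antisym[OF pX, of w] by (metis Un_iff subsetD)
qed

lemma stem_near_tip:
  assumes x: "x \<in> X" "x \<noteq> t" and U: "open U" "x \<in> U" and F: "finite F"
  obtains u where "u \<in> stem x" "u \<in> U" "u \<noteq> x" "u \<notin> F"
proof -
  have "x islimpt stem x"
    by (rule connected_islimpt[OF connected_stem[OF x(1)] stem_ends(2,1)[OF x(1)] x(2)])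
  moreover have "open (U - (F - {x}))"
    using U F by (simp add: finite_imp_closed open_Diff)
  ultimately obtain u where "u \<in> stem x" "u \<in> U - (F - {x})" "u \<noteq> x"
    using U unfolding islimpt_def by (metis DiffD2 DiffI insertI1)
  then show ?thesis using that by blast
qed

text \<open>The continuum \<open>C \<union> stem q\<close> contains \<open>stem e\<close>, and \<open>stem q\<close> stays away from \<open>e\<close> by maximality.
So every nondegenerate continuum through a maximal point contains the last part of its stem.\<close>

lemma stem_near_maximal_tip:
  assumes e: "e \<in> X" "\<And>z. z \<in> X \<Longrightarrow> e \<in> stem z \<Longrightarrow> z = e"
    and C: "continuum C" "C \<subseteq> X" "e \<in> C" "q \<in> C" "q \<noteq> e"
  obtains U where "open U" "e \<in> U" "stem e \<inter> U \<subseteq> C"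
proof -
  have q: "q \<in> X" using C by blast
  have "continuum (C \<union> stem q)"
    using continuum_Un[OF C(1) stem_continuum[OF q]] C(4) stem_ends(2)[OF q] by blast
  then have "stem e \<subseteq> C \<union> stem q"
    using stem_least[OF e(1), of "C \<union> stem q"] C stem_subset[OF q] stem_ends(1)[OF q] by simp
  moreover have "e \<notin> stem q" using e(2)[OF q] C(5) by blast
  moreover have "open (- stem q)" using closed_stem[OF q] by (rule open_Compl)
  ultimately show ?thesis using that[of "- stem q"] by blast
qed

text \<open>A point with something above it is the common end of its stem and of an arc going up. Conversely, any two
arcs ending at a maximal point both contain the last part of its stem, so they cannot be disjoint
beyond it.\<close>

lemma endpoints_iff_maximal:
  assumes e: "e \<in> X" "e \<noteq> t"
  shows "e \<in> endpoints X \<longleftrightarrow> (\<forall>z\<in>X. e \<in> stem z \<longrightarrow> z = e)"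
proof
  assume "e \<in> endpoints X"
  then have order: "point_order X e = 1" by (simp add: endpoints_def)
  show "\<forall>z\<in>X. e \<in> stem z \<longrightarrow> z = e"
  proof (intro ballI impI, rule ccontr)
    fix z assume z: "z \<in> X" "e \<in> stem z" "z \<noteq> e"
    define A where "A = {w \<in> stem z. e \<in> stem w}"
    have A: "arc_between A e z" "A \<subseteq> X"
      using arc_between_upper_stem[OF z(1,2)] z(3) stem_subset[OF z(1)] unfolding A_def by auto
    have S: "arc_between (stem e) e t" "stem e \<subseteq> X"
      using arc_between_stem[OF e] arc_between_sym by blast+
    have "A \<inter> stem e \<subseteq> {e}"
      using stem_antisym[OF e(1)] unfolding A_def by blast
    then have int: "A \<inter> stem e = {e}"
      using continuum_arc_between(2)[OF A(1)] stem_ends(2)[OF e(1)] by blast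
    have "A \<noteq> stem e"
      using int continuum_arc_between(3,4)[OF A(1)] by (metis Int_absorb singletonD)
    then have "card {A, stem e} = 2" by simp
    moreover have "enat (card {A, stem e}) \<le> point_order X e"
    proof (rule card_le_point_order)
      show "pairwise (\<lambda>A B. A \<inter> B = {e}) {A, stem e}"
        using int by (auto simp: pairwise_def Int_commute)
    qed (use A S in auto)
    ultimately show False
      using order by (simp add: one_enat_def)
  qed
next
  assume max: "\<forall>z\<in>X. e \<in> stem z \<longrightarrow> z = e"
  then have max': "\<And>z. z \<in> X \<Longrightarrow> e \<in> stem z \<Longrightarrow> z = e" by blast
  have "enat (card {stem e}) \<le> point_order X e"
    by (rule card_le_point_order)
      (use arc_between_stem(2)[OF e] arc_between_sym[OF arc_between_stem(1)[OF e]] in auto)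
  then have "1 \<le> point_order X e" by (simp add: one_enat_def)
  moreover have "point_order X e \<le> 1"
    unfolding point_order_def
  proof (rule Sup_least, safe)
    fix F :: "'a set set"
    assume F: "finite F" "\<forall>A\<in>F. A \<subseteq> X \<and> (\<exists>q. arc_between A e q)"
      "pairwise (\<lambda>A B. A \<inter> B = {e}) F"
    have "A = B" if AB: "A \<in> F" "B \<in> F" for A B
    proof (rule ccontr)
      assume "A \<noteq> B"
      then have int: "A \<inter> B = {e}" using F(3) AB by (auto simp: pairwise_def)
      have near: "\<exists>U. open U \<and> e \<in> U \<and> stem e \<inter> U \<subseteq> C" if "C \<in> F" for C
      proof -
        have C: "C \<subseteq> X" "\<exists>q. arc_between C e q"
          using bspec[OF F(2) that] by simp_all
        obtain q where q: "arc_between C e q" using C(2) by (rule exE)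
        show ?thesis
          by (rule stem_near_maximal_tip[OF e(1) max' continuum_arc_between(1)[OF q] C(1)
              continuum_arc_between(2,3)[OF q] continuum_arc_between(4)[OF q, symmetric]])
            (assumption | rule exI conjI)+
      qed
      obtain U where U: "open U" "e \<in> U" "stem e \<inter> U \<subseteq> A" using near[OF AB(1)] by blast
      obtain V where V: "open V" "e \<in> V" "stem e \<inter> V \<subseteq> B" using near[OF AB(2)] by blast
      obtain u where "u \<in> stem e" "u \<in> U \<inter> V" "u \<noteq> e"
        using stem_near_tip[OF e, of "U \<inter> V" "{}"] U V by blast
      then show False using U V int by blast
    qed
    then have "card F \<le> Suc 0"
      using card_le_Suc0_iff_eq[OF F(1)] by blast
    then show "enat (card F) \<le> 1" by (simp add: one_enat_def)
  qed
  ultimately show "e \<in> endpoints X"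
    using e(1) by (simp add: endpoints_def)
qed

section \<open>Shadows of open sets\<close>

definition shadow :: "'a set \<Rightarrow> 'a set" where
  "shadow V = {x \<in> X. stem x \<inter> V \<noteq> {}}"

lemma shadow_subset: "shadow U \<subseteq> X"
  unfolding shadow_def by blast

lemma connected_not_shadow: "connected (X - shadow V)"
proof -
  have eq: "X - shadow V = \<Union>(stem ` (X - shadow V))"
  proof (intro equalityI subsetI)
    fix x assume "x \<in> \<Union>(stem ` (X - shadow V))"
    then obtain y where y: "y \<in> X" "stem y \<inter> V = {}" "x \<in> stem y"
      by (auto simp: shadow_def)
    then have "x \<in> X" "stem x \<subseteq> stem y"
      using stem_subset[of y] stem_mono[of y x] by auto
    with y(2) show "x \<in> X - shadow V"
      unfolding shadow_def by blast
  next
    fix x assume "x \<in> X - shadow V"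
    then show "x \<in> \<Union>(stem ` (X - shadow V))"
      using stem_ends(2)[of x] by blast
  qed
  have "connected (\<Union>(stem ` (X - shadow V)))"
  proof (rule connected_Union)
    show "connected s" if "s \<in> stem ` (X - shadow V)" for s
      using connected_stem that by blast
    have "t \<in> \<Inter>(stem ` (X - shadow V))"
      using stem_ends(1) by blast
    then show "\<Inter>(stem ` (X - shadow V)) \<noteq> {}"
      by blast
  qed
  then show ?thesis using eq by simp
qed

text \<open>The closure of the complement of a shadow is a subcontinuum that contains the root and avoids
\<open>V\<close>, so it contains the stems of all its points, and these avoid \<open>V\<close> as well. This is lower
semicontinuity of \<open>x \<mapsto> stem x\<close>, obtained without limits of sets.\<close>

lemma closed_not_shadow:
  assumes "open V"
  shows "closed (X - shadow V)"
proof -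
  let ?C = "closure (X - shadow V)"
  have sub: "?C \<subseteq> X - V"
  proof (rule closure_minimal)
    show "X - shadow V \<subseteq> X - V"
      using stem_ends(2) unfolding shadow_def by blast
  qed (rule closed_Diff[OF closed_X assms])
  have cont: "continuum ?C"
    unfolding continuum_def
    using connected_imp_connected_closure[OF connected_not_shadow] sub
      compact_Int_closed[OF compact_X closed_closure, of "X - shadow V"]
    by (simp add: inf.absorb2 subset_iff)
  have "?C \<subseteq> X - shadow V"
  proof
    fix x assume x: "x \<in> ?C"
    then have "X - shadow V \<noteq> {}" by (metis closure_empty empty_iff)
    then obtain z where "z \<in> X - shadow V" by auto
    then have "t \<in> X - shadow V"
      using root stem_ends(1)[of z] by (auto simp: shadow_def)
    then have "t \<in> ?C"
      by (rule subsetD[OF closure_subset])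
    moreover have "x \<in> X" "?C \<subseteq> X"
      using x sub by auto
    ultimately have "stem x \<subseteq> ?C"
      using stem_least[OF _ cont] x by simp
    then show "x \<in> X - shadow V"
      using x sub unfolding shadow_def by blast
  qed
  then show ?thesis
    using closure_subset_eq by blast
qed

lemma shadow_open:
  assumes "open V"
  obtains W where "open W" "shadow V = X \<inter> W"
proof
  show "open (- (X - shadow V))"
    using closed_not_shadow[OF assms] by (rule open_Compl)
  show "shadow V = X \<inter> - (X - shadow V)"
    unfolding shadow_def by blast
qed

lemma shadow_superset: "X \<inter> V \<subseteq> shadow V"
  using stem_ends(2) unfolding shadow_def by blast

lemma shadow_mono: "V \<inter> X \<subseteq> W \<Longrightarrow> shadow V \<subseteq> shadow W"
  using stem_subset unfolding shadow_def by blast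

section \<open>Clusters\<close>

text \<open>\<open>a \<in> cluster y\<close> means that \<open>y\<close> is a limit of points \<open>y\<^sub>n \<in> stem a\<^sub>n\<close> for some sequence
\<open>a\<^sub>n\<close> converging to \<open>a\<close>. The closures make the set closed and let compactness be applied without
extracting subsequences.\<close>

definition cluster :: "'a \<Rightarrow> 'a set" where
  "cluster y = (\<Inter>U\<in>{U. open U \<and> y \<in> U}. closure (shadow U))"

lemma closed_cluster: "closed (cluster y)"
  unfolding cluster_def by (intro closed_INT) simp

lemma cluster_subset: "cluster y \<subseteq> X"
proof -
  have "cluster y \<subseteq> closure (shadow UNIV)"
    unfolding cluster_def by blast
  also have "\<dots> \<subseteq> X"
    using closure_minimal[OF shadow_subset closed_X] .
  finally show ?thesis .
qed

lemma compact_cluster: "compact (cluster y)"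
  using compact_Int_closed[OF compact_X closed_cluster] cluster_subset by (metis inf.absorb2)

lemma clusterD:
  assumes "a \<in> cluster y" "open U" "y \<in> U" "open V" "a \<in> V"
  obtains z where "z \<in> X" "stem z \<inter> U \<noteq> {}" "z \<in> V"
proof -
  have "a \<in> closure (shadow U)"
    using assms unfolding cluster_def by blast
  then have "V \<inter> shadow U \<noteq> {}"
    using open_Int_closure_eq_empty[OF assms(4)] assms(5) by blast
  then show ?thesis
    using that unfolding shadow_def by blast
qed

lemma clusterI:
  assumes "\<And>U V. open U \<Longrightarrow> y \<in> U \<Longrightarrow> open V \<Longrightarrow> a \<in> V \<Longrightarrow> \<exists>z\<in>X. stem z \<inter> U \<noteq> {} \<and> z \<in> V"
  shows "a \<in> cluster y"
proof -
  have "a \<in> closure (shadow U)" if U: "open U" "y \<in> U" for U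
  proof (rule ccontr)
    assume "a \<notin> closure (shadow U)"
    then have "a \<in> - closure (shadow U)" "open (- closure (shadow U))"
      by auto
    then obtain z where "z \<in> X" "stem z \<inter> U \<noteq> {}" "z \<in> - closure (shadow U)"
      using assms[OF U] by blast
    then show False
      using closure_subset[of "shadow U"] unfolding shadow_def by blast
  qed
  then show ?thesis unfolding cluster_def by simp
qed

lemma upper_in_cluster:
  assumes "a \<in> X" "y \<in> stem a"
  shows "a \<in> cluster y"
  by (rule clusterI) (use assms in blast)

text \<open>The closures of the shadows of the neighbourhoods of \<open>y\<close> are a downward directed family of
compact sets with intersection \<open>cluster y\<close>, so one of them already fits into \<open>W\<close>.\<close>

lemma shadow_near_cluster:
  assumes W: "open W" "cluster y \<subseteq> W"
  obtains U where "open U" "y \<in> U" "shadow U \<subseteq> W"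
proof -
  have "\<exists>U. open U \<and> y \<in> U \<and> (X - W) \<inter> closure (shadow U) = {}"
  proof (rule ccontr)
    assume none: "\<nexists>U. open U \<and> y \<in> U \<and> (X - W) \<inter> closure (shadow U) = {}"
    have "(X - W) \<inter> (\<Inter>U\<in>{U. open U \<and> y \<in> U}. closure (shadow U)) \<noteq> {}"
    proof (rule compact_imp_fip_image)
      show "compact (X - W)"
        using compact_X W(1) by (rule compact_diff)
      show "closed (closure (shadow U))" for U by simp
      show "(X - W) \<inter> (\<Inter>U\<in>I. closure (shadow U)) \<noteq> {}"
        if I: "finite I" "I \<subseteq> {U. open U \<and> y \<in> U}" for I
      proof -
        have "open (\<Inter>I) \<and> y \<in> \<Inter>I"
          using I by (auto intro: open_Inter)
        then have "(X - W) \<inter> closure (shadow (\<Inter>I)) \<noteq> {}"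
          using none by blast
        moreover have "closure (shadow (\<Inter>I)) \<subseteq> (\<Inter>U\<in>I. closure (shadow U))"
          by (intro INT_greatest closure_mono shadow_mono) blast
        ultimately show ?thesis by blast
      qed
    qed
    then show False
      using W(2) unfolding cluster_def by blast
  qed
  then obtain U where U: "open U" "y \<in> U" "(X - W) \<inter> closure (shadow U) = {}" by blast
  then have "shadow U \<subseteq> W"
    using shadow_subset[of U] closure_subset[of "shadow U"] by blast
  with U that show ?thesis by blast
qed

text \<open>The shadows themselves need not be connected. But if the cluster splits, separate the parts by open
sets \<open>P\<close>, containing \<open>y\<close>, and \<open>Q\<close>. The shadow of a small neighbourhood of \<open>y\<close> lies in \<open>P \<union> Q\<close>
and is a union of connected upsets starting in \<open>P\<close>, so it never reaches \<open>Q\<close>.\<close>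

lemma connected_cluster:
  assumes "y \<in> X"
  shows "connected (cluster y)"
proof -
  have part: "B = {}"
    if AB: "closed A" "closed B" "A \<union> B = cluster y" "A \<inter> B = {}" "y \<in> A" for A B
  proof (rule ccontr)
    assume "B \<noteq> {}"
    then obtain b where b: "b \<in> B" by blast
    obtain P Q where PQ: "open P" "open Q" "A \<subseteq> P" "B \<subseteq> Q" "P \<inter> Q = {}"
      using t4_space[OF AB(1,2,4)] by blast
    obtain U where U: "open U" "y \<in> U" "shadow U \<subseteq> P \<union> Q"
      using shadow_near_cluster[of "P \<union> Q" y] PQ AB(3) by blast
    have "b \<in> cluster y" "b \<in> Q" using b AB(3) PQ by auto
    moreover have "open (U \<inter> P)" "y \<in> U \<inter> P"
      using U PQ AB(5) by auto
    ultimately obtain z where z: "z \<in> X" "stem z \<inter> (U \<inter> P) \<noteq> {}" "z \<in> Q"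
      using clusterD[of b y "U \<inter> P" Q] PQ(2) by blast
    then obtain x where x: "x \<in> stem z" "x \<in> U" "x \<in> P" by blast
    then have xX: "x \<in> X" using stem_subset[OF z(1)] by blast
    have sub: "{w \<in> X. x \<in> stem w} \<subseteq> P \<union> Q"
      using U(3) x(2) unfolding shadow_def by blast
    have "P \<inter> {w \<in> X. x \<in> stem w} \<noteq> {}" "Q \<inter> {w \<in> X. x \<in> stem w} \<noteq> {}"
      using x z xX stem_ends(2)[OF xX] by auto
    moreover have "P \<inter> Q \<inter> {w \<in> X. x \<in> stem w} = {}"
      using PQ(5) by blast
    ultimately show False
      using connectedD[OF connected_upset PQ(1,2) _ sub] by blast
  qed
  have y: "y \<in> cluster y"
    using upper_in_cluster[OF assms stem_ends(2)[OF assms]] .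
  show ?thesis
    unfolding connected_closed_set[OF closed_cluster]
  proof
    assume "\<exists>A B. closed A \<and> closed B \<and> A \<noteq> {} \<and> B \<noteq> {} \<and> A \<union> B = cluster y \<and> A \<inter> B = {}"
    then obtain A B where AB: "closed A" "closed B" "A \<noteq> {}" "B \<noteq> {}" "A \<union> B = cluster y"
      "A \<inter> B = {}" by blast
    show False
    proof (cases "y \<in> A")
      case True
      then show False using part[OF AB(1,2,5,6)] AB(4) by blast
    next
      case False
      then have "y \<in> B" "B \<union> A = cluster y" "B \<inter> A = {}"
        using y AB(5,6) by auto
      then show False using part[OF AB(2,1)] AB(3) by blast
    qed
  qed
qed

lemma cluster_continuum:
  assumes "y \<in> X"
  shows "continuum (cluster y)" "y \<in> cluster y" "cluster y \<subseteq> X"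
  using connected_cluster[OF assms] compact_cluster cluster_subset
    upper_in_cluster[OF assms stem_ends(2)[OF assms]] by (auto simp: continuum_def)

section \<open>Smoothness at a point in terms of clusters\<close>

text \<open>By \<open>upper_in_cluster\<close> the converse implication always holds; the condition excludes exactly the limits of
nearby stems that exceed \<open>stem a\<close>.\<close>

definition smooth_at :: "'a \<Rightarrow> bool" where
  "smooth_at a \<longleftrightarrow> (\<forall>y\<in>X. a \<in> cluster y \<longrightarrow> y \<in> stem a)"

text \<open>If smoothness fails at \<open>a\<close>, with \<open>a \<in> cluster y\<close> and \<open>y \<notin> stem a\<close>, then \<open>a\<close> is in the closure of the
shadow of a basic neighbourhood of \<open>y\<close> that misses \<open>stem a\<close>, but not in this shadow. The
bad points are thus covered by countably many boundaries of open sets.\<close>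

lemma exists_smooth_at:
  assumes W: "open W" "W \<inter> X \<noteq> {}"
  obtains a where "a \<in> W" "a \<in> X" "smooth_at a"
proof -
  obtain \<B> where B: "countable \<B>" "\<And>B. B \<in> \<B> \<Longrightarrow> open B"
    "\<And>y V. y \<in> X \<Longrightarrow> open V \<Longrightarrow> y \<in> V \<Longrightarrow> \<exists>B\<in>\<B>. y \<in> B \<and> B \<subseteq> V"
    using compact_countable_base[OF compact_X] by metis
  define T where "T = (\<lambda>B. closure (shadow B) \<inter> (X - shadow B))"
  obtain a where a: "a \<in> W" "a \<in> X" "a \<notin> \<Union>(T ` \<B>)"
  proof (rule Baire_compact[OF compact_X, of "T ` \<B>" W])
    show "countable (T ` \<B>)" using B(1) by simp
    show "closed S \<and> S \<subseteq> X" if "S \<in> T ` \<B>" for S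
      using that B(2) closed_not_shadow unfolding T_def by auto
    show "\<not> V \<inter> X \<subseteq> S" if S: "S \<in> T ` \<B>" and V: "open V" "V \<inter> X \<noteq> {}" for S V
    proof
      assume sub: "V \<inter> X \<subseteq> S"
      obtain D where D: "S = T D" using S by blast
      have "V \<inter> closure (shadow D) \<noteq> {}" using sub V(2) unfolding D T_def by blast
      then have "V \<inter> shadow D \<noteq> {}"
        using open_Int_closure_eq_empty[OF V(1)] by blast
      then show False
        using sub shadow_subset[of D] unfolding D T_def by blast
    qed
  qed (use W that in auto)
  have "y \<in> stem a" if y: "y \<in> X" "a \<in> cluster y" for y
  proof (rule ccontr)
    assume "y \<notin> stem a"
    then have "y \<in> - stem a" "open (- stem a)"
      using closed_stem[OF a(2)] by auto
    then obtain D where D: "D \<in> \<B>" "y \<in> D" "D \<subseteq> - stem a"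
      using B(3)[OF y(1), of "- stem a"] by blast
    have "a \<in> closure (shadow D)"
      using y(2) D(2) B(2)[OF D(1)] unfolding cluster_def by blast
    moreover have "a \<notin> shadow D"
      using D(3) unfolding shadow_def by blast
    ultimately show False
      using a(2,3) D(1) unfolding T_def by blast
  qed
  then show ?thesis
    using that a(1,2) unfolding smooth_at_def by blast
qed

text \<open>At a point of smoothness the missing half of continuity holds: each point outside \<open>N\<close>
has a neighbourhood that the stems of points near \<open>a\<close> avoid, and finitely many of these
neighbourhoods suffice.\<close>

lemma stem_upper_semicontinuous:
  assumes a: "a \<in> X" "smooth_at a" and N: "open N" "stem a \<subseteq> N"
  obtains V where "open V" "a \<in> V" "\<And>x. x \<in> X \<Longrightarrow> x \<in> V \<Longrightarrow> stem x \<subseteq> N"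
proof -
  have "\<exists>U V. open U \<and> y \<in> U \<and> open V \<and> a \<in> V \<and> (\<forall>z\<in>X. stem z \<inter> U \<noteq> {} \<longrightarrow> z \<notin> V)"
    if y: "y \<in> X - N" for y
  proof (rule ccontr)
    assume "\<nexists>U V. open U \<and> y \<in> U \<and> open V \<and> a \<in> V \<and> (\<forall>z\<in>X. stem z \<inter> U \<noteq> {} \<longrightarrow> z \<notin> V)"
    then have "a \<in> cluster y"
      by (intro clusterI) blast
    then show False
      using a(2) y N(2) unfolding smooth_at_def by blast
  qed
  then obtain U V where UV: "\<And>y. y \<in> X - N \<Longrightarrow> open (U y) \<and> y \<in> U y \<and> open (V y) \<and> a \<in> V y
      \<and> (\<forall>z\<in>X. stem z \<inter> U y \<noteq> {} \<longrightarrow> z \<notin> V y)"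
    by metis
  have "compact (X - N)"
    using compact_X N(1) by (rule compact_diff)
  then obtain D where D: "D \<subseteq> X - N" "finite D" "X - N \<subseteq> (\<Union>y\<in>D. U y)"
    by (rule compactE_image[of "X - N" "X - N" U]) (use UV in blast)+
  show ?thesis
  proof
    show "open (\<Inter>y\<in>D. V y)"
      using D(1,2) UV by (intro open_INT) blast+
    show "a \<in> (\<Inter>y\<in>D. V y)"
      using D(1) UV by blast
    show "stem x \<subseteq> N" if x: "x \<in> X" "x \<in> (\<Inter>y\<in>D. V y)" for x
    proof (rule ccontr)
      assume "\<not> stem x \<subseteq> N"
      then obtain w where w: "w \<in> stem x" "w \<in> X - N"
        using stem_subset[OF x(1)] by blast
      then obtain y where "y \<in> D" "w \<in> U y"
        using D(3) by blast
      then show False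
        using UV[of y] D(1) w(1) x by blast
    qed
  qed
qed

lemma stem_lower_semicontinuous:
  assumes a: "a \<in> X" and e: "e > 0"
  obtains V where "open V" "a \<in> V"
    "\<And>x z. x \<in> X \<Longrightarrow> x \<in> V \<Longrightarrow> z \<in> stem a \<Longrightarrow> infdist z (stem x) \<le> e"
proof -
  have "\<exists>W. open W \<and> shadow (ball z (e/2)) = X \<inter> W" for z
    using shadow_open[OF open_ball] by metis
  then obtain W where W: "\<And>z. open (W z)" "\<And>z. shadow (ball z (e/2)) = X \<inter> W z"
    by metis
  have "stem a \<subseteq> (\<Union>z\<in>stem a. ball z (e/2))"
    using e by auto
  then obtain D where D: "D \<subseteq> stem a" "finite D" "stem a \<subseteq> (\<Union>z\<in>D. ball z (e/2))"
    using compactE_image[OF compact_stem[OF a], of "stem a" "\<lambda>z. ball z (e/2)"] by (metis open_ball)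
  show ?thesis
  proof
    show "open (\<Inter>z\<in>D. W z)"
      using D(2) W(1) by (intro open_INT) blast+
    have "a \<in> shadow (ball z (e/2))" if "z \<in> D" for z
    proof -
      have "z \<in> stem a \<inter> ball z (e/2)" using that D(1) e by auto
      then show ?thesis using a unfolding shadow_def by blast
    qed
    then show "a \<in> (\<Inter>z\<in>D. W z)"
      using W(2) by blast
    show "infdist z (stem x) \<le> e"
      if x: "x \<in> X" "x \<in> (\<Inter>z\<in>D. W z)" and z: "z \<in> stem a" for x z
    proof -
      obtain c where c: "c \<in> D" "dist c z < e/2"
        using D(3) z by auto
      then have "x \<in> shadow (ball c (e/2))"
        using x W(2) by blast
      then obtain w where w: "w \<in> stem x" "dist c w < e/2"
        unfolding shadow_def by auto
      have "infdist z (stem x) \<le> dist z w"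
        using w(1) by (rule infdist_le)
      also have "\<dots> \<le> dist z c + dist c w"
        by (rule dist_triangle)
      also have "\<dots> \<le> e"
        using w(2) c(2) by (simp add: dist_commute)
      finally show ?thesis .
    qed
  qed
qed

text \<open>The two semicontinuity lemmas control the two halves of the Hausdorff distance.\<close>

lemma smooth_wrt_iff:
  assumes a: "a \<in> X"
  shows "smooth_wrt X t a \<longleftrightarrow> smooth_at a"
proof
  assume sm: "smooth_at a"
  show "smooth_wrt X t a"
    unfolding smooth_wrt_def
  proof (intro allI impI, elim conjE)
    fix s :: "nat \<Rightarrow> 'a"
    assume sX: "\<forall>n. s n \<in> X" and lim: "s \<longlonglongrightarrow> a"
    show "(\<lambda>n. hausdorff_dist (stem (s n)) (stem a)) \<longlonglongrightarrow> 0"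
    proof (rule tendstoI)
      fix e :: real assume e: "e > 0"
      have "open {y. infdist y (stem a) < e/2}"
        by (intro open_Collect_less continuous_on_infdist continuous_intros)
      moreover have "stem a \<subseteq> {y. infdist y (stem a) < e/2}"
        using e by auto
      ultimately obtain V1 where V1: "open V1" "a \<in> V1"
        "\<And>x. x \<in> X \<Longrightarrow> x \<in> V1 \<Longrightarrow> stem x \<subseteq> {y. infdist y (stem a) < e/2}"
        using stem_upper_semicontinuous[OF a sm] by metis
      obtain V2 where V2: "open V2" "a \<in> V2"
        "\<And>x z. x \<in> X \<Longrightarrow> x \<in> V2 \<Longrightarrow> z \<in> stem a \<Longrightarrow> infdist z (stem x) \<le> e/2"
        using stem_lower_semicontinuous[OF a, of "e/2"] e by (metis half_gt_zero)
      have "\<forall>\<^sub>F n in sequentially. s n \<in> V1 \<inter> V2"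
        using topological_tendstoD[OF lim, of "V1 \<inter> V2"] V1(1,2) V2(1,2) by auto
      then show "\<forall>\<^sub>F n in sequentially. dist (hausdorff_dist (stem (s n)) (stem a)) 0 < e"
      proof (rule eventually_mono)
        fix n assume n: "s n \<in> V1 \<inter> V2"
        have X: "s n \<in> X" using sX by simp
        have "hausdorff_dist (stem (s n)) (stem a) \<le> e/2"
        proof (rule hausdorff_dist_leI)
          show "stem (s n) \<noteq> {}" "stem a \<noteq> {}"
            using stem_ends(1)[OF X] stem_ends(1)[OF a] by auto
          show "infdist y (stem a) \<le> e/2" if "y \<in> stem (s n)" for y
            using V1(3)[OF X] n that by fastforce
          show "infdist z (stem (s n)) \<le> e/2" if "z \<in> stem a" for z
            using V2(3)[OF X] n that by blast
        qed
        moreover have "0 \<le> hausdorff_dist (stem (s n)) (stem a)"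
          using infdist_le_hausdorff_dist[OF compact_stem[OF X] stem_ends(1)[OF X], of "stem a"]
            infdist_nonneg[of t "stem a"] by linarith
        ultimately show "dist (hausdorff_dist (stem (s n)) (stem a)) 0 < e"
          using e by (simp add: dist_real_def)
      qed
    qed
  qed
next
  assume sm: "smooth_wrt X t a"
  have "y \<in> stem a" if y: "y \<in> X" "a \<in> cluster y" for y
  proof -
    have "\<exists>z\<in>X. stem z \<inter> ball y (1 / real (Suc n)) \<noteq> {} \<and> z \<in> ball a (1 / real (Suc n))" for n
    proof -
      have "(0::real) < 1 / real (Suc n)" by simp
      then have "y \<in> ball y (1 / real (Suc n))" "a \<in> ball a (1 / real (Suc n))"
        by (simp_all del: of_nat_Suc)
      then show ?thesis
        using clusterD[OF y(2) open_ball _ open_ball] by metis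
    qed
    then obtain s where s: "\<And>n. s n \<in> X" "\<And>n. stem (s n) \<inter> ball y (1 / real (Suc n)) \<noteq> {}"
      "\<And>n. s n \<in> ball a (1 / real (Suc n))"
      by metis
    have "\<exists>w. w \<in> stem (s n) \<and> dist y w < 1 / real (Suc n)" for n
      using s(2)[of n] by (metis disjoint_iff mem_ball)
    then obtain w where w: "\<And>n. w n \<in> stem (s n)" "\<And>n. dist y (w n) < 1 / real (Suc n)"
      by metis
    have null: "(\<lambda>n. 1 / real (Suc n)) \<longlonglongrightarrow> 0"
      using LIMSEQ_inverse_real_of_nat by (simp add: inverse_eq_divide)
    have "s \<longlonglongrightarrow> a"
    proof (rule metric_tendsto_imp_tendsto[OF null])
      show "\<forall>\<^sub>F n in sequentially. dist (s n) a \<le> dist (1 / real (Suc n)) 0"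
        using s(3) by (auto simp: dist_commute less_imp_le simp del: of_nat_Suc intro!: always_eventually)
    qed
    then have "(\<lambda>n. hausdorff_dist (stem (s n)) (stem a)) \<longlonglongrightarrow> 0"
      using sm s(1) unfolding smooth_wrt_def by blast
    then have lim: "(\<lambda>n. hausdorff_dist (stem (s n)) (stem a) + 1 / real (Suc n)) \<longlonglongrightarrow> 0 + 0"
      using null by (rule tendsto_add)
    have bound: "infdist y (stem a) \<le> hausdorff_dist (stem (s n)) (stem a) + 1 / real (Suc n)" for n
    proof -
      have "infdist y (stem a) \<le> infdist (w n) (stem a) + dist y (w n)"
        by (rule infdist_triangle)
      also have "\<dots> \<le> hausdorff_dist (stem (s n)) (stem a) + 1 / real (Suc n)"
        using infdist_le_hausdorff_dist[OF compact_stem[OF s(1)] w(1), of n "stem a"] w(2)[of n]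
        by linarith
      finally show ?thesis .
    qed
    have "infdist y (stem a) \<le> 0 + 0"
      by (rule LIMSEQ_le_const[OF lim]) (use bound in blast)
    then have "infdist y (stem a) = 0"
      using infdist_nonneg[of y "stem a"] by linarith
    then show ?thesis
      using in_closed_iff_infdist_zero[OF closed_stem[OF a]] stem_ends(1)[OF a] by blast
  qed
  then show "smooth_at a"
    unfolding smooth_at_def by blast
qed

section \<open>Every point lies below a maximal one\<close>

text \<open>Suppose there is no bound, and let \<open>L m\<close> be the closure of the part \<open>T m\<close> of the ray
formed by the stems that lies above \<open>x m\<close>. Let \<open>y\<close> be an accumulation point of the sequence; some \<open>x N\<close> is
not below \<open>y\<close>. Since \<open>stem y\<close> is contained in \<open>stem (x m) \<union> L m\<close> and connected, it has a point in both
parts, which lies below \<open>x N\<close>. So the continuum \<open>L m\<close> reaches down below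
\<open>x N\<close>, hence contains \<open>x N\<close> and everything above it: every tail of the ray is dense in
\<open>L N\<close>. By assumption each point of \<open>L N\<close> fails to be above some \<open>x n\<close>, so \<open>L N\<close> is covered by
countably many closed sets of points whose stems avoid a basic neighbourhood of some \<open>x n\<close>. These sets are nowhere
dense because they miss a tail of the ray, which contradicts Baire's theorem.\<close>

lemma increasing_stems_bounded:
  fixes x :: "nat \<Rightarrow> 'a"
  assumes xX: "\<And>n. x n \<in> X" and inc: "\<And>n. x n \<in> stem (x (Suc n))"
  shows "\<exists>y\<in>X. \<forall>n. x n \<in> stem y"
proof (rule ccontr)
  assume "\<not> (\<exists>y\<in>X. \<forall>n. x n \<in> stem y)"
  then have unbdd: "\<exists>n. x n \<notin> stem y" if "y \<in> X" for y
    using that by blast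
  have mono: "x m \<in> stem (x n)" if "m \<le> n" for m n
    using that
  proof (induction n rule: dec_induct)
    case base
    show ?case by (rule stem_ends(2)[OF xX])
  next
    case (step n)
    then show ?case using stem_trans[OF xX inc] by blast
  qed
  define T where "T = (\<lambda>m. \<Union>k\<in>{m..}. {w \<in> stem (x k). x m \<in> stem w})"
  define L where "L = (\<lambda>m. closure (T m))"
  have x_T: "x n \<in> T m" if "m \<le> n" for m n
    using that mono[OF that] stem_ends(2)[OF xX] unfolding T_def by blast
  have T_X: "T m \<subseteq> X" for m
    unfolding T_def using stem_subset[OF xX] by blast
  then have L_X: "L m \<subseteq> X" for m
    unfolding L_def by (simp add: closure_minimal closed_X)
  have T_L: "T m \<subseteq> L m" for m
    unfolding L_def by (rule closure_subset)
  have T_conn: "connected (T m)" for m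
    unfolding T_def
  proof (rule connected_Union)
    show "connected s" if "s \<in> (\<lambda>k. {w \<in> stem (x k). x m \<in> stem w}) ` {m..}" for s
      using that connected_upper_stem[OF xX mono] by auto
    have "x m \<in> \<Inter>((\<lambda>k. {w \<in> stem (x k). x m \<in> stem w}) ` {m..})"
      using mono stem_ends(2)[OF xX] by auto
    then show "\<Inter>((\<lambda>k. {w \<in> stem (x k). x m \<in> stem w}) ` {m..}) \<noteq> {}" by blast
  qed
  have L_cont: "continuum (L m)" for m
    unfolding continuum_def
    using connected_imp_connected_closure[OF T_conn] compact_Int_closed[OF compact_X, of "L m"] L_X[of m]
    by (simp add: L_def inf.absorb2)
  obtain y r where y: "y \<in> X" "strict_mono (r :: nat \<Rightarrow> nat)" "(x \<circ> r) \<longlonglongrightarrow> y"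
    using compact_X xX unfolding compact_def by meson
  have y_L: "y \<in> L m" for m
  proof -
    have "\<forall>\<^sub>F n in sequentially. (x \<circ> r) n \<in> L m"
    proof (rule eventually_sequentiallyI)
      fix n assume "m \<le> n"
      then have "m \<le> r n" using seq_suble[OF y(2), of n] by linarith
      then show "(x \<circ> r) n \<in> L m" using x_T T_L by auto
    qed
    then show ?thesis
      using Lim_in_closed_set[OF _ _ _ y(3)] unfolding L_def by simp
  qed
  obtain N where N: "x N \<notin> stem y" using unbdd[OF y(1)] by blast
  \<comment> \<open>Every tail of the ray accumulates at \<open>x N\<close>.\<close>
  have xN_L: "x N \<in> L m" if m: "N \<le> m" for m
  proof -
    have "continuum (stem (x m) \<union> L m)"
      using continuum_Un[OF stem_continuum[OF xX] L_cont] stem_ends(2)[OF xX] x_T[of m m] T_L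
      by blast
    then have cover: "stem y \<subseteq> stem (x m) \<union> L m"
      using stem_least[OF y(1), of "stem (x m) \<union> L m"] stem_ends(1)[OF xX] y_L
        stem_subset[OF xX] L_X by simp
    have "closed (stem (x m))" "closed (L m)"
      using closed_stem[OF xX] unfolding L_def by simp_all
    moreover have "stem (x m) \<inter> stem y \<noteq> {}" "L m \<inter> stem y \<noteq> {}"
      using stem_ends[OF xX] stem_ends[OF y(1)] y_L by blast+
    ultimately have "stem (x m) \<inter> L m \<inter> stem y \<noteq> {}"
      using connected_closedD[OF connected_stem[OF y(1)] _ cover] by blast
    then obtain p where p: "p \<in> stem y" "p \<in> stem (x m)" "p \<in> L m" by blast
    have "x N \<notin> stem p" using N stem_trans[OF y(1) p(1)] by blast
    then have "p \<in> stem (x N)"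
      using stem_linear[OF xX p(2) mono[OF m]] by blast
    then show ?thesis
      using upper_stem_least[OF xX p(2) L_cont L_X p(3) _ mono[OF m]] x_T[of m m] T_L by blast
  qed
  have x_L: "x n \<in> L m" if "N \<le> n" "N \<le> m" for n m
  proof (cases "m \<le> n")
    case True
    then show ?thesis using x_T T_L by blast
  next
    case False
    then show ?thesis
      using upper_stem_least[OF xX mono[OF that(2)] L_cont L_X xN_L[OF that(2)] _ mono mono[OF that(1)]]
        x_T[of m m] T_L by auto
  qed
  have T_L': "T N \<subseteq> L m" if m: "N \<le> m" for m
  proof
    fix w assume "w \<in> T N"
    then obtain k where k: "N \<le> k" "w \<in> stem (x k)" "x N \<in> stem w"
      unfolding T_def by auto
    show "w \<in> L m"
      using upper_stem_least[OF xX mono[OF k(1)] L_cont L_X xN_L[OF m] x_L[OF k(1) m] k(2,3)] .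
  qed
  have L_sub: "L N \<subseteq> L m" if m: "N \<le> m" for m
    using closure_minimal[OF T_L'[OF m]] unfolding L_def by simp
  obtain \<B> where B: "countable \<B>" "\<And>B. B \<in> \<B> \<Longrightarrow> open B"
    "\<And>y V. y \<in> X \<Longrightarrow> open V \<Longrightarrow> y \<in> V \<Longrightarrow> \<exists>B\<in>\<B>. y \<in> B \<and> B \<subseteq> V"
    using compact_countable_base[OF compact_X] by metis
  define \<G> where "\<G> = (\<lambda>B. L N \<inter> (X - shadow B)) ` {B \<in> \<B>. \<exists>n. x n \<in> B}"
  obtain z where z: "z \<in> UNIV" "z \<in> L N" "z \<notin> \<Union>\<G>"
  proof (rule Baire_compact[of "L N" \<G> UNIV])
    show "compact (L N)" using L_cont by (simp add: continuum_def)
    show "countable \<G>" unfolding \<G>_def using B(1) by simp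
    show "closed S \<and> S \<subseteq> L N" if "S \<in> \<G>" for S
      using that B(2) closed_not_shadow unfolding \<G>_def L_def by auto
    show "UNIV \<inter> L N \<noteq> {}" using y_L by blast
    show "\<not> W \<inter> L N \<subseteq> S" if S: "S \<in> \<G>" and W: "open W" "W \<inter> L N \<noteq> {}" for S W
    proof -
      obtain B n where Bn: "S = L N \<inter> (X - shadow B)" "x n \<in> B"
        using S unfolding \<G>_def by blast
      define m where "m = max n N"
      have "W \<inter> L m \<noteq> {}"
        using W(2) L_sub[of m] unfolding m_def by auto
      then have "W \<inter> T m \<noteq> {}"
        unfolding L_def using open_Int_closure_eq_empty[OF W(1)] by blast
      then obtain w k where w: "w \<in> W" "m \<le> k" "w \<in> stem (x k)" "x m \<in> stem w"
        unfolding T_def by auto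
      then have wX: "w \<in> X" using stem_subset[OF xX] by blast
      have "x n \<in> stem w" "x N \<in> stem w"
        using stem_trans[OF wX w(4)] mono[of n m] mono[of N m] unfolding m_def by auto
      then have "w \<in> shadow B" "w \<in> T N"
        using wX Bn(2) w(2,3) unfolding shadow_def T_def m_def by auto
      then show ?thesis
        using w(1) Bn(1) T_L by blast
    qed
  qed (use that in auto)
  have zX: "z \<in> X" using z(2) L_X by blast
  obtain n where n: "x n \<notin> stem z" using unbdd[OF zX] by blast
  obtain D where D: "D \<in> \<B>" "x n \<in> D" "D \<subseteq> - stem z"
    using B(3)[OF xX, of "- stem z" n] closed_stem[OF zX] n by auto
  then have "z \<notin> shadow D" unfolding shadow_def by blast
  then show False
    using z(2,3) zX D(1,2) unfolding \<G>_def by blast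
qed

text \<open>Choose an increasing sequence of stems greedily so that the \<open>n\<close>-th step meets the \<open>n\<close>-th basic
open set whenever some larger stem does. An upper bound of the sequence has no point strictly above
it, since such a point would have a basic neighbourhood that the greedy choice overlooked.\<close>

lemma maximal_stem_above:
  assumes "x \<in> X"
  obtains y where "y \<in> X" "x \<in> stem y" "\<And>z. z \<in> X \<Longrightarrow> y \<in> stem z \<Longrightarrow> z = y"
proof -
  obtain \<B> where B: "countable \<B>" "\<And>B. B \<in> \<B> \<Longrightarrow> open B"
    "\<And>y V. y \<in> X \<Longrightarrow> open V \<Longrightarrow> y \<in> V \<Longrightarrow> \<exists>B\<in>\<B>. y \<in> B \<and> B \<subseteq> V"
    using compact_countable_base[OF compact_X] by metis
  have "\<B> \<noteq> {}" using B(3)[OF root, of UNIV] by auto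
  then have enum: "\<exists>n. D = from_nat_into \<B> n" if "D \<in> \<B>" for D
    using from_nat_into_surj[OF B(1) that] by metis
  have "\<exists>f. (f 0 \<in> X \<and> x \<in> stem (f 0)) \<and> (\<forall>n. f n \<in> X \<and> x \<in> stem (f n)) \<and>
     (\<forall>n. f n \<in> stem (f (Suc n)) \<and> (\<forall>z\<in>X. f n \<in> stem z \<longrightarrow> stem z \<inter> from_nat_into \<B> n \<noteq> {} \<longrightarrow>
       stem (f (Suc n)) \<inter> from_nat_into \<B> n \<noteq> {}))"
  proof -
    have "\<exists>f. \<forall>n. (f n \<in> X \<and> x \<in> stem (f n)) \<and>
     (f n \<in> stem (f (Suc n)) \<and> (\<forall>z\<in>X. f n \<in> stem z \<longrightarrow> stem z \<inter> from_nat_into \<B> n \<noteq> {} \<longrightarrow>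
       stem (f (Suc n)) \<inter> from_nat_into \<B> n \<noteq> {}))"
    proof (rule dependent_nat_choice)
      show "\<exists>u. u \<in> X \<and> x \<in> stem u" using assms stem_ends(2) by blast
      show "\<exists>v. (v \<in> X \<and> x \<in> stem v) \<and> u \<in> stem v \<and> (\<forall>z\<in>X. u \<in> stem z \<longrightarrow>
          stem z \<inter> from_nat_into \<B> n \<noteq> {} \<longrightarrow> stem v \<inter> from_nat_into \<B> n \<noteq> {})"
        if u: "u \<in> X \<and> x \<in> stem u" for u n
      proof (cases "\<exists>z\<in>X. u \<in> stem z \<and> stem z \<inter> from_nat_into \<B> n \<noteq> {}")
        case True
        then obtain z where z: "z \<in> X" "u \<in> stem z" "stem z \<inter> from_nat_into \<B> n \<noteq> {}" by blast
        then have "x \<in> stem z" using stem_trans[OF z(1,2)] u by blast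
        with z show ?thesis by blast
      next
        case False
        then show ?thesis using u stem_ends(2) by blast
      qed
    qed
    then show ?thesis by blast
  qed
  then obtain f where f: "\<And>n. f n \<in> X" "\<And>n. x \<in> stem (f n)" "\<And>n. f n \<in> stem (f (Suc n))"
    "\<And>n z. z \<in> X \<Longrightarrow> f n \<in> stem z \<Longrightarrow> stem z \<inter> from_nat_into \<B> n \<noteq> {} \<Longrightarrow>
       stem (f (Suc n)) \<inter> from_nat_into \<B> n \<noteq> {}"
    by blast
  obtain y where y: "y \<in> X" "\<And>n. f n \<in> stem y"
    using increasing_stems_bounded[of f, OF f(1,3)] by blast
  have "z = y" if z: "z \<in> X" "y \<in> stem z" for z
  proof -
    have "z \<in> stem y"
    proof (rule ccontr)
      assume "z \<notin> stem y"
      then obtain D where D: "D \<in> \<B>" "z \<in> D" "D \<subseteq> - stem y"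
        using B(3)[OF z(1), of "- stem y"] closed_stem[OF y(1)] by auto
      obtain n where n: "D = from_nat_into \<B> n" using enum[OF D(1)] by blast
      have "f n \<in> stem z" using stem_trans[OF z y(2)] .
      moreover have "stem z \<inter> D \<noteq> {}" using stem_ends(2)[OF z(1)] D(2) by blast
      ultimately have "stem (f (Suc n)) \<inter> D \<noteq> {}"
        using f(4)[OF z(1)] unfolding n by blast
      then show False
        using stem_mono[OF y(1) y(2), of "Suc n"] D(3) by blast
    qed
    then show ?thesis using stem_antisym[OF y(1)] z(2) by blast
  qed
  then show ?thesis
    using that[OF y(1)] stem_trans[OF y(1) y(2) f(2)] by blast
qed

section \<open>Homeomorphisms fixing the root\<close>

lemma stem_image_superset:
  assumes "continuous_on X h" "h ` X \<subseteq> X" "h t = t" "x \<in> X"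
  shows "stem (h x) \<subseteq> h ` stem x"
proof (rule stem_least)
  have "continuous_on (stem x) h"
    using assms(1) stem_subset[OF assms(4)] by (rule continuous_on_subset)
  then show "continuum (h ` stem x)"
    using compact_stem[OF assms(4)] connected_stem[OF assms(4)] unfolding continuum_def
    by (simp add: compact_continuous_image connected_continuous_image)
  show "h ` stem x \<subseteq> X" using assms(2) stem_subset[OF assms(4)] by blast
  show "t \<in> h ` stem x" using stem_ends(1)[OF assms(4)] assms(3) by (metis imageI)
  show "h x \<in> h ` stem x" using stem_ends(2)[OF assms(4)] by (rule imageI)
  show "h x \<in> X" using assms(2,4) by blast
qed

text \<open>Both inclusions come from minimality of stems, applied to \<open>h\<close> and to its inverse.\<close>

lemma homeomorphism_stem:
  assumes h: "homeomorphism X X h k" "h t = t" and x: "x \<in> X"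
  shows "stem (h x) = h ` stem x"
proof
  show "stem (h x) \<subseteq> h ` stem x"
    using stem_image_superset[of h x, OF _ _ h(2) x] h(1) by (simp add: homeomorphism_def)
  have hx: "h x \<in> X" and k: "k (h x) = x" "k t = t"
    using h x root homeomorphism_apply1[OF h(1)] homeomorphism_image1[OF h(1)] by (blast, metis, metis)
  have "stem x \<subseteq> k ` stem (h x)"
    using stem_image_superset[of k "h x", OF _ _ k(2) hx] h(1) k(1) by (simp add: homeomorphism_def)
  then have "h ` stem x \<subseteq> h ` k ` stem (h x)" by (rule image_mono)
  also have "\<dots> = stem (h x)"
    using homeomorphism_apply2[OF h(1)] stem_subset[OF hx] by (force simp: image_image)
  finally show "h ` stem x \<subseteq> stem (h x)" .
qed

lemma homeomorphism_cluster:
  assumes h: "homeomorphism X X h k" "h t = t" and a: "a \<in> cluster y" and y: "y \<in> X"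
  shows "h a \<in> cluster (h y)"
proof (rule clusterI)
  fix U V assume U: "open U" "h y \<in> U" and V: "open V" "h a \<in> V"
  have cont: "continuous_on X h" using h(1) by (simp add: homeomorphism_def)
  obtain U' where U': "open U'" "U' \<inter> X = h -` U \<inter> X"
    using cont U(1) unfolding continuous_on_open_invariant by blast
  obtain V' where V': "open V'" "V' \<inter> X = h -` V \<inter> X"
    using cont V(1) unfolding continuous_on_open_invariant by blast
  have "y \<in> U'" "a \<in> V'"
    using U' V' U(2) V(2) y a cluster_subset[of y] by blast+
  then obtain z where z: "z \<in> X" "stem z \<inter> U' \<noteq> {}" "z \<in> V'"
    using clusterD[OF a U'(1) _ V'(1)] by blast
  then obtain w where w: "w \<in> stem z" "w \<in> U'" by blast
  have "w \<in> X" using w(1) stem_subset[OF z(1)] by blast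
  then have "h w \<in> U" using U'(2) w(2) by blast
  moreover have "h w \<in> stem (h z)"
    using homeomorphism_stem[OF h z(1)] w(1) by blast
  moreover have "h z \<in> X" "h z \<in> V"
    using homeomorphism_image1[OF h(1)] z V'(2) by blast+
  ultimately show "\<exists>z\<in>X. stem z \<inter> U \<noteq> {} \<and> z \<in> V" by blast
qed

lemma homeomorphism_smooth_at:
  assumes h: "homeomorphism X X h k" "h t = t" and a: "smooth_at a" "a \<in> X"
  shows "smooth_at (h a)"
  unfolding smooth_at_def
proof (intro ballI impI)
  fix y assume y: "y \<in> X" "h a \<in> cluster y"
  have sym: "homeomorphism X X k h" "k t = t"
    using h homeomorphism_symD homeomorphism_apply1[OF h(1) root] by auto
  have "k (h a) \<in> cluster (k y)"
    using homeomorphism_cluster[OF sym y(2,1)] .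
  then have "a \<in> cluster (k y)"
    using homeomorphism_apply1[OF h(1) a(2)] by simp
  moreover have ky: "k y \<in> X" using homeomorphism_image1[OF sym(1)] y(1) by blast
  ultimately have "k y \<in> stem a"
    using a(1) unfolding smooth_at_def by blast
  then have "h (k y) \<in> stem (h a)"
    using homeomorphism_stem[OF h a(2)] by blast
  then show "y \<in> stem (h a)"
    using homeomorphism_apply2[OF h(1) y(1)] by simp
qed

end


section \<open>Fans\<close>

locale fan = rooted_dendroid +
  assumes ramification: "ramification_points X = {t}"

begin

abbreviation E :: "'a set" where "E \<equiv> endpoints X"

lemma point_order_root: "point_order X t > 2"
  using ramification unfolding ramification_points_def by blast

lemma root_not_endpoint: "t \<notin> E"
  using point_order_root unfolding endpoints_def by (auto simp: one_enat_def numeral_eq_enat)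

lemma endpoints_subset: "E \<subseteq> X"
  unfolding endpoints_def by blast

lemma endpoint_maximal: "e \<in> E \<Longrightarrow> z \<in> X \<Longrightarrow> e \<in> stem z \<Longrightarrow> z = e"
  using endpoints_iff_maximal[of e] endpoints_subset root_not_endpoint by blast

lemma exists_other_point: "\<exists>q\<in>X. q \<noteq> t"
proof (rule ccontr)
  assume none: "\<not> (\<exists>q\<in>X. q \<noteq> t)"
  have "point_order X t \<le> 0"
    unfolding point_order_def
  proof (rule Sup_least, safe)
    fix F :: "'a set set"
    assume F: "\<forall>A\<in>F. A \<subseteq> X \<and> (\<exists>q. arc_between A t q)"
    have "A \<notin> F" for A
    proof
      assume "A \<in> F"
      then have A: "A \<subseteq> X" "\<exists>q. arc_between A t q"
        using bspec[OF F] by simp_all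
      obtain q where q: "arc_between A t q" using A(2) by (rule exE)
      show False
        using none A(1) continuum_arc_between(3,4)[OF q] by (metis subsetD)
    qed
    then have "F = {}" by blast
    then show "enat (card F) \<le> 0" by (simp add: zero_enat_def)
  qed
  then show False using point_order_root by simp
qed

lemma endpoint_above:
  assumes "x \<in> X"
  obtains e where "e \<in> E" "x \<in> stem e"
proof -
  have *: thesis if x: "x \<in> X" "x \<noteq> t" "\<And>e. e \<in> E \<Longrightarrow> x \<in> stem e \<Longrightarrow> thesis" for x thesis
  proof -
    obtain y where y: "y \<in> X" "x \<in> stem y" "\<And>z. z \<in> X \<Longrightarrow> y \<in> stem z \<Longrightarrow> z = y"
      using maximal_stem_above[OF x(1)] by metis
    have "y \<noteq> t" using y(2) x(2) by auto
    then have "y \<in> E" using endpoints_iff_maximal[OF y(1)] y(3) by blast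
    then show thesis using x(3) y(2) by blast
  qed
  show ?thesis
  proof (cases "x = t")
    case True
    obtain q where "q \<in> X" "q \<noteq> t" using exists_other_point by blast
    then obtain e where "e \<in> E" by (rule *)
    then show ?thesis using that True stem_ends(1) endpoints_subset by blast
  next
    case False
    then show ?thesis using * assms that by blast
  qed
qed

text \<open>Let \<open>c\<close> be the last common point of the two stems. If \<open>c\<close> is neither \<open>x\<close> nor \<open>y\<close>, then going down
and going up towards \<open>x\<close> and \<open>y\<close> are three arcs at \<open>c\<close>, so \<open>c\<close> is the top.\<close>

lemma stems_comparable:
  assumes x: "x \<in> X" and y: "y \<in> X" and z: "z \<in> stem x" "z \<in> stem y" "z \<noteq> t"
  shows "x \<in> stem y \<or> y \<in> stem x"
proof -
  have "x \<noteq> t" using z by auto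
  then obtain g where g: "arc g" "g ` {0..1} = stem x" "g 0 = t" "g 1 = x"
    "\<And>s. s \<in> {0..1} \<Longrightarrow> stem (g s) = g ` {0..s}"
    using stem_parametrization[OF x] by metis
  have "continuous_on {0..1} g" using g(1) by (simp add: arc_def path_def)
  then have "closed ({0..1} \<inter> g -` stem y)"
    by (intro continuous_closed_preimage closed_stem y) simp_all
  then have "compact ({0..1} \<inter> ({0..1} \<inter> g -` stem y))"
    by (intro compact_Int_closed) simp_all
  moreover obtain s1 where "s1 \<in> {0..1}" "z = g s1" using z(1) g(2) by (metis imageE)
  then have "{0..1} \<inter> ({0..1} \<inter> g -` stem y) \<noteq> {}" using z(2) by blast
  ultimately obtain s where s: "s \<in> {0..1} \<inter> ({0..1} \<inter> g -` stem y)"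
    "\<And>r. r \<in> {0..1} \<inter> ({0..1} \<inter> g -` stem y) \<Longrightarrow> r \<le> s"
    using compact_attains_sup by metis
  define c where "c = g s"
  have cx: "c \<in> stem x" and cy: "c \<in> stem y"
    using s(1) g(2) unfolding c_def by auto
  have cX: "c \<in> X" using cx stem_subset[OF x] by blast
  have below: "w \<in> stem c" if w: "w \<in> stem x" "w \<in> stem y" for w
  proof -
    obtain r where r: "r \<in> {0..1}" "w = g r" using w(1) g(2) by (metis imageE)
    then have "r \<le> s" using s(2) w(2) by auto
    then show ?thesis using g(5)[of s] s(1) r unfolding c_def by auto
  qed
  have ct: "c \<noteq> t" using below[OF z(1,2)] z(3) by auto
  show ?thesis
  proof (rule ccontr)
    assume neg: "\<not> (x \<in> stem y \<or> y \<in> stem x)"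
    then have cne: "c \<noteq> x" "c \<noteq> y" using cx cy by auto
    define A where "A = {w \<in> stem x. c \<in> stem w}"
    define B where "B = {w \<in> stem y. c \<in> stem w}"
    have arcs: "arc_between (stem c) c t" "arc_between A c x" "arc_between B c y"
      using arc_between_sym[OF arc_between_stem(1)[OF cX ct]] arc_between_upper_stem[OF x cx cne(1)]
        arc_between_upper_stem[OF y cy cne(2)] unfolding A_def B_def by auto
    have sub: "stem c \<subseteq> X" "A \<subseteq> X" "B \<subseteq> X"
      using stem_subset[OF cX] stem_subset[OF x] stem_subset[OF y] unfolding A_def B_def by auto
    have mem: "c \<in> stem c" "c \<in> A" "c \<in> B" "x \<in> A" "y \<in> B"
      using arcs[THEN continuum_arc_between(2)] arcs[THEN continuum_arc_between(3)] by auto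
    have only_c: "w = c" if "w \<in> stem c" "c \<in> stem w" for w
      using stem_antisym[OF cX that] by simp
    have int: "stem c \<inter> A = {c}" "stem c \<inter> B = {c}" "A \<inter> B = {c}"
      using only_c below mem unfolding A_def B_def by blast+
    have ne: "stem c \<noteq> A" "stem c \<noteq> B" "A \<noteq> B"
      using int mem cne by (metis Int_absorb singletonD)+
    have "enat (card {stem c, A, B}) \<le> point_order X c"
    proof (rule card_le_point_order)
      show "pairwise (\<lambda>A B. A \<inter> B = {c}) {stem c, A, B}"
        using int by (auto simp: pairwise_def Int_commute)
    qed (use arcs sub in auto)
    moreover have "card {stem c, A, B} = 3" using ne by simp
    moreover have "2 < enat 3" by (simp add: numeral_eq_enat)
    ultimately have "point_order X c > 2" by (metis less_le_trans)
    then have "c \<in> ramification_points X"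
      using cX unfolding ramification_points_def by blast
    then show False using ramification ct by blast
  qed
qed

lemma endpoint_above_unique:
  assumes "e \<in> E" "e' \<in> E" "x \<in> stem e" "x \<in> stem e'" "x \<noteq> t"
  shows "e = e'"
  using stems_comparable[of e e' x] assms endpoints_subset endpoint_maximal by blast

text \<open>The points of order two.\<close>

abbreviation inner :: "'a set" where "inner \<equiv> X - E - {t}"

lemma inner_below:
  assumes y: "y \<in> X" and u: "u \<in> stem y" "u \<noteq> y" "u \<noteq> t"
  shows "u \<in> inner"
  using endpoint_maximal[of u y] stem_subset[OF y] assms by blast

lemma inner_near_tip:
  assumes x: "x \<in> X" "x \<noteq> t" and U: "open U" "x \<in> U"
  obtains u where "u \<in> stem x" "u \<in> U" "u \<noteq> x" "u \<in> inner"
proof -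
  obtain u where "u \<in> stem x" "u \<in> U" "u \<noteq> x" "u \<notin> {t}"
    by (rule stem_near_tip[OF x U, of "{t}"]) simp
  then show ?thesis using that inner_below[OF x(1)] by blast
qed

lemma homeomorphism_root:
  assumes h: "homeomorphism X X h k"
  shows "h t = t"
proof -
  have "h t \<in> X" using homeomorphism_image1[OF h] root by blast
  moreover have "point_order X (h t) > 2"
    using point_order_homeomorphism[OF h root] point_order_root by simp
  ultimately have "h t \<in> ramification_points X"
    unfolding ramification_points_def by blast
  then show ?thesis using ramification by blast
qed

lemma homeomorphism_endpoint:
  assumes h: "homeomorphism X X h k" and x: "x \<in> X"
  shows "h x \<in> E \<longleftrightarrow> x \<in> E"
  using point_order_homeomorphism[OF h x] homeomorphism_image1[OF h] x
  unfolding endpoints_def by auto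

lemma homeomorphism_inner:
  assumes h: "homeomorphism X X h k" and x: "x \<in> inner"
  shows "h x \<in> inner"
proof -
  have xX: "x \<in> X" "x \<notin> E" "x \<noteq> t" using x by auto
  have "h x \<noteq> t"
    using homeomorphism_root[OF h] homeomorphism_apply1[OF h] xX root by metis
  moreover have "h x \<in> X" using homeomorphism_image1[OF h] xX by blast
  ultimately show ?thesis using homeomorphism_endpoint[OF h xX(1)] xX(2) by blast
qed

text \<open>If \<open>t\<close> lies in the cluster of \<open>y \<noteq> t\<close>, then so does \<open>stem y\<close>, and an inner point \<open>u\<close> strictly below \<open>y\<close>
is not a point of smoothness. If an endpoint \<open>e\<close> lies in the cluster of a point \<open>y\<close> on a different arm,
then the cluster, being a continuum containing \<open>y\<close> and \<open>e\<close>, contains \<open>t\<close>, which reduces to the first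
case.\<close>

lemma smooth_if_inner_smooth:
  assumes inner: "\<And>u. u \<in> inner \<Longrightarrow> smooth_at u" and a: "a \<in> X"
  shows "smooth_at a"
proof -
  have top: "y = t" if y: "y \<in> X" "t \<in> cluster y" for y
  proof (rule ccontr)
    assume "y \<noteq> t"
    then obtain u where u: "u \<in> stem y" "u \<noteq> y" "u \<in> inner"
      using inner_near_tip[OF y(1) _ open_UNIV] by blast
    have "stem y \<subseteq> cluster y"
      using stem_least[OF y(1) cluster_continuum(1,3)[OF y(1)] y(2) cluster_continuum(2)[OF y(1)]] .
    then have "y \<in> stem u"
      using inner[OF u(3)] u(1) y(1) unfolding smooth_at_def by blast
    then show False using stem_antisym[OF y(1) u(1)] u(2) by blast
  qed
  have tip: "y \<in> stem e" if e: "e \<in> E" and y: "y \<in> X" "e \<in> cluster y" for e y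
  proof (rule ccontr)
    assume n: "y \<notin> stem e"
    have eX: "e \<in> X" using e endpoints_subset by blast
    have yt: "y \<noteq> t" using n stem_ends(1)[OF eX] by blast
    have n': "e \<notin> stem y" using endpoint_maximal[OF e y(1)] n stem_ends(2)[OF eX] by blast
    have "t \<notin> cluster y" using top[OF y(1)] yt by blast
    then have disj: "stem y \<inter> stem e \<inter> (cluster y \<inter> (stem y \<union> stem e)) = {}"
      using stems_comparable[OF y(1) eX] n n' by blast
    have "continuum (stem y \<union> stem e)" "stem y \<union> stem e \<subseteq> X"
      using continuum_Un[OF stem_continuum[OF y(1)] stem_continuum[OF eX]]
        stem_ends(1)[OF y(1)] stem_ends(1)[OF eX] stem_subset[OF y(1)] stem_subset[OF eX] by blast+
    then have "connected (cluster y \<inter> (stem y \<union> stem e))"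
      by (rule dendroid_continuum_Int_connected[OF dendroid cluster_continuum(1,3)[OF y(1)]])
    then have "stem y \<inter> (cluster y \<inter> (stem y \<union> stem e)) = {} \<or>
        stem e \<inter> (cluster y \<inter> (stem y \<union> stem e)) = {}"
      by (rule connected_closedD[OF _ disj _ closed_stem[OF y(1)] closed_stem[OF eX]]) blast
    then show False
      using stem_ends(2)[OF y(1)] stem_ends(2)[OF eX] y(2) cluster_continuum(2)[OF y(1)] by blast
  qed
  show ?thesis
    using inner[of a] top tip[of a] a unfolding smooth_at_def by (cases "a \<in> E"; cases "a = t") auto
qed

end


section \<open>Fans with three orbits\<close>

locale three_orbit_fan = fan +
  assumes homogeneous: "inv_n_homogeneous 3 X"

begin

lemma exists_endpoint: "\<exists>e. e \<in> E"
  using endpoint_above[OF root] by blast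

lemma exists_inner: "\<exists>u. u \<in> inner"
proof -
  obtain q where "q \<in> X" "q \<noteq> t" using exists_other_point by blast
  then show ?thesis using inner_near_tip[OF _ _ open_UNIV] by (metis UNIV_I)
qed

lemma homeo_orbit_self: "x \<in> homeo_orbit X x"
proof -
  have "homeomorphism X X id id" by (simp add: homeomorphism_def)
  then show ?thesis unfolding homeo_orbit_def by (metis (mono_tags, lifting) id_apply mem_Collect_eq)
qed

lemma homeo_orbit_subsets:
  shows "homeo_orbit X t \<subseteq> {t}" "e \<in> E \<Longrightarrow> homeo_orbit X e \<subseteq> E" "u \<in> inner \<Longrightarrow> homeo_orbit X u \<subseteq> inner"
  using homeomorphism_root homeomorphism_endpoint homeomorphism_inner endpoints_subset
  unfolding homeo_orbit_def by blast+

text \<open>The three orbits listed lie in the disjoint invariant sets formed by the top, the endpoints and the inner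
points, so they are distinct and there is no room for another.\<close>

lemma homeo_orbits:
  assumes e: "e \<in> E" and u: "u \<in> inner"
  shows "homeo_orbit X ` X = {homeo_orbit X t, homeo_orbit X e, homeo_orbit X u}"
proof -
  let ?S = "{homeo_orbit X t, homeo_orbit X e, homeo_orbit X u}"
  have "homeo_orbit X t \<noteq> homeo_orbit X e" "homeo_orbit X t \<noteq> homeo_orbit X u"
    "homeo_orbit X e \<noteq> homeo_orbit X u"
    using homeo_orbit_subsets(1) homeo_orbit_subsets(2)[OF e] homeo_orbit_subsets(3)[OF u]
      homeo_orbit_self[of e] homeo_orbit_self[of u] homeo_orbit_self[of t] root_not_endpoint by blast+
  then have "card ?S = 3" by simp
  moreover have "?S \<subseteq> homeo_orbit X ` X" using e u root endpoints_subset by blast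
  moreover have "finite (homeo_orbit X ` X)" "card (homeo_orbit X ` X) = 3"
    using homogeneous unfolding inv_n_homogeneous_def by auto
  ultimately show ?thesis using card_subset_eq by metis
qed

lemma endpoint_homogeneous:
  assumes "e \<in> E" "e' \<in> E"
  obtains h k where "homeomorphism X X h k" "h e = e'"
proof -
  obtain u where u: "u \<in> inner" using exists_inner by blast
  have "homeo_orbit X e' \<in> {homeo_orbit X t, homeo_orbit X e, homeo_orbit X u}"
    using homeo_orbits[OF assms(1) u] assms(2) endpoints_subset by blast
  then have "e' \<in> homeo_orbit X e"
    using homeo_orbit_self[of e'] homeo_orbit_subsets(1) homeo_orbit_subsets(3)[OF u]
      assms(2) root_not_endpoint by blast
  then show ?thesis using that unfolding homeo_orbit_def by blast
qed

lemma inner_homogeneous: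
  assumes "u \<in> inner" "u' \<in> inner"
  obtains h k where "homeomorphism X X h k" "h u = u'"
proof -
  obtain e where e: "e \<in> E" using exists_endpoint by blast
  have "homeo_orbit X u' \<in> {homeo_orbit X t, homeo_orbit X e, homeo_orbit X u}"
    using homeo_orbits[OF e assms(1)] assms(2) by blast
  then have "u' \<in> homeo_orbit X u"
    using homeo_orbit_self[of u'] homeo_orbit_subsets(1) homeo_orbit_subsets(2)[OF e]
      assms(2) by blast
  then show ?thesis using that unfolding homeo_orbit_def by blast
qed

end


section \<open>Non-smooth fans with three orbits\<close>

locale nonsmooth_three_orbit_fan = three_orbit_fan +
  assumes nonsmooth: "\<not> smooth X"

begin

text \<open>By homogeneity one inner point of smoothness would make all of them so.\<close>

lemma inner_not_smooth:
  assumes "u \<in> inner"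
  shows "\<not> smooth_at u"
proof
  assume u: "smooth_at u"
  have "smooth_at v" if v: "v \<in> inner" for v
  proof -
    obtain h k where h: "homeomorphism X X h k" "h u = v"
      using inner_homogeneous[OF assms v] .
    then show ?thesis
      using homeomorphism_smooth_at[OF h(1) homeomorphism_root[OF h(1)] u] assms by blast
  qed
  then have "smooth_at a" if "a \<in> X" for a
    by (rule smooth_if_inner_smooth[OF _ that])
  then have "smooth X"
    unfolding smooth_def using root smooth_wrt_iff by blast
  then show False using nonsmooth by contradiction
qed

text \<open>The top is not isolated, so \<open>W\<close> contains a point of smoothness other than \<open>t\<close>, and such a point
cannot be inner.\<close>

lemma endpoints_dense:
  assumes W: "open W" "W \<inter> X \<noteq> {}"
  obtains e where "e \<in> E" "e \<in> W" "smooth_at e"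
proof -
  have "t islimpt X"
    using connected_islimpt[OF connected_X root] exists_other_point by metis
  then have "\<exists>y\<in>X. y \<in> W \<and> y \<noteq> t" if "t \<in> W"
    using that W(1) unfolding islimpt_def by simp
  then have "(W - {t}) \<inter> X \<noteq> {}"
    using W(2) by auto
  then obtain a where a: "a \<in> W - {t}" "a \<in> X" "smooth_at a"
    by (rule exists_smooth_at[OF open_delete[OF W(1)]])
  then have "a \<in> E" using inner_not_smooth[of a] by blast
  with a that show ?thesis by blast
qed

lemma endpoint_smooth:
  assumes "e \<in> E"
  shows "smooth_at e"
proof -
  obtain e' where e': "e' \<in> E" "smooth_at e'"
    using endpoints_dense[OF open_UNIV] root by blast
  obtain h k where h: "homeomorphism X X h k" "h e' = e"
    using endpoint_homogeneous[OF e'(1) assms] .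
  then show ?thesis
    using homeomorphism_smooth_at[OF h(1) homeomorphism_root[OF h(1)] e'(2)] e'(1) endpoints_subset
    by blast
qed

text \<open>One oscillation. Start at an endpoint \<open>e\<close> in \<open>G\<close>: as \<open>t\<close> is in its cluster, the shadow of \<open>G\<close> meets
\<open>Q\<close>, and it does so in an endpoint \<open>e'\<close>. The stem of \<open>e'\<close> passes through a point \<open>v\<close> of \<open>G\<close>, and \<open>v\<close> is
in the cluster of \<open>e'\<close>, so there are stems that first visit \<open>G\<close>, then \<open>Q\<close> near \<open>e'\<close>, and
end in \<open>G\<close> near \<open>v\<close>. By openness of shadows this persists on an open subset of \<open>G\<close>.\<close>

lemma returning_open_subset:
  assumes ret: "\<And>e u. e \<in> E \<Longrightarrow> u \<in> stem e \<Longrightarrow> u \<in> cluster e"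
    and G: "open G" "G \<inter> X \<noteq> {}" and Q: "open Q" "t \<in> Q"
  obtains H where "open H" "H \<inter> X \<noteq> {}" "closure H \<subseteq> G"
    "\<And>y. y \<in> H \<Longrightarrow> y \<in> X \<Longrightarrow> \<exists>q\<in>stem y. q \<in> Q \<and> stem q \<inter> G \<noteq> {}"
proof -
  obtain e where e: "e \<in> E" "e \<in> G" using endpoints_dense[OF G] by blast
  then have "t \<in> cluster e" using ret stem_ends(1) endpoints_subset by blast
  then obtain z where z: "z \<in> X" "stem z \<inter> G \<noteq> {}" "z \<in> Q"
    by (rule clusterD[OF _ G(1) e(2) Q])
  obtain W where W: "open W" "shadow G = X \<inter> W" by (rule shadow_open[OF G(1)])
  have "z \<in> shadow G" using z unfolding shadow_def by blast
  then have "W \<inter> Q \<inter> X \<noteq> {}" using W(2) z(1,3) by blast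
  then obtain e' where e': "e' \<in> E" "e' \<in> W \<inter> Q"
    using endpoints_dense[OF open_Int[OF W(1) Q(1)]] by blast
  then have e'X: "e' \<in> X" using endpoints_subset by blast
  then have "e' \<in> shadow G" using W(2) e'(2) by blast
  then obtain v where v: "v \<in> stem e'" "v \<in> G" unfolding shadow_def by blast
  obtain z' where z': "z' \<in> X" "stem z' \<inter> (W \<inter> Q) \<noteq> {}" "z' \<in> G"
    by (rule clusterD[OF ret[OF e'(1) v(1)] open_Int[OF W(1) Q(1)] e'(2) G(1) v(2)])
  obtain W' where W': "open W'" "shadow (W \<inter> Q) = X \<inter> W'"
    by (rule shadow_open[OF open_Int[OF W(1) Q(1)]])
  have "z' \<in> shadow (W \<inter> Q)" using z' unfolding shadow_def by blast
  then have "z' \<in> G \<inter> W'" "open (G \<inter> W')" using W' z'(3) G(1) by auto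
  then obtain r where r: "r > 0" "cball z' r \<subseteq> G \<inter> W'"
    unfolding open_contains_cball by blast
  show ?thesis
  proof
    show "open (ball z' r)" by simp
    show "ball z' r \<inter> X \<noteq> {}" using r(1) z'(1) centre_in_ball by (metis IntI empty_iff)
    have "closure (ball z' r) \<subseteq> cball z' r" by (rule closure_minimal) auto
    then show "closure (ball z' r) \<subseteq> G" using r(2) by blast
    show "\<exists>q\<in>stem y. q \<in> Q \<and> stem q \<inter> G \<noteq> {}" if y: "y \<in> ball z' r" "y \<in> X" for y
    proof -
      have "y \<in> W'" using y(1) r(2) by auto
      then have "y \<in> shadow (W \<inter> Q)" using W'(2) y(2) by blast
      then obtain q where q: "q \<in> stem y" "q \<in> W" "q \<in> Q" unfolding shadow_def by blast
      then have "q \<in> X" using stem_subset[OF y(2)] by blast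
      then have "q \<in> shadow G" using W(2) q(2) by blast
      then show ?thesis using q unfolding shadow_def by blast
    qed
  qed
qed

text \<open>Nested applications of the preceding lemma, with \<open>G\<close> far from the ball \<open>Q\<close> around the top, produce a
point \<open>y\<close> whose stem oscillates between the two regions any number of times. By uniform continuity of a
parametrization each oscillation uses up parameter length at least \<open>\<eta>\<close>.\<close>

lemma no_return:
  assumes ret: "\<And>e u. e \<in> E \<Longrightarrow> u \<in> stem e \<Longrightarrow> u \<in> cluster e"
  shows False
proof -
  obtain e where e: "e \<in> E" using exists_endpoint by blast
  then have eX: "e \<in> X" and et: "e \<noteq> t" using endpoints_subset root_not_endpoint by auto
  \<comment> \<open>With a third of the distance the balls around \<open>e\<close> and \<open>t\<close> are still \<open>d\<close> apart.\<close>
  define d where "d = dist e t / 3"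
  have d: "d > 0" using et by (simp add: d_def)
  have far: "d \<le> dist p q" if "p \<in> ball e d" "q \<in> ball t d" for p q
  proof -
    have "dist e t \<le> dist e p + dist p q + dist q t"
      using dist_triangle[of e t p] dist_triangle[of p t q] by linarith
    then show ?thesis using that by (simp add: d_def dist_commute)
  qed
  have step: "\<exists>H. (open H \<and> H \<inter> X \<noteq> {} \<and> H \<subseteq> ball e d) \<and> (closure H \<subseteq> G \<and>
      (\<forall>y\<in>H \<inter> X. \<exists>q\<in>stem y. q \<in> ball t d \<and> stem q \<inter> G \<noteq> {}))"
    if G: "open G \<and> G \<inter> X \<noteq> {} \<and> G \<subseteq> ball e d" for G
  proof -
    obtain H where H: "open H" "H \<inter> X \<noteq> {}" "closure H \<subseteq> G"
      "\<And>y. y \<in> H \<Longrightarrow> y \<in> X \<Longrightarrow> \<exists>q\<in>stem y. q \<in> ball t d \<and> stem q \<inter> G \<noteq> {}"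
      using returning_open_subset[OF ret, of G "ball t d"] G d by (metis centre_in_ball open_ball)
    moreover have "H \<subseteq> ball e d" using H(3) closure_subset[of H] G by blast
    ultimately show ?thesis by blast
  qed
  have base: "\<exists>G. open G \<and> G \<inter> X \<noteq> {} \<and> G \<subseteq> ball e d"
    using eX d centre_in_ball open_ball by (metis IntI empty_iff order_refl)
  have "\<exists>G. \<forall>n. (open (G n) \<and> G n \<inter> X \<noteq> {} \<and> G n \<subseteq> ball e d) \<and> (closure (G (Suc n)) \<subseteq> G n \<and>
      (\<forall>y\<in>G (Suc n) \<inter> X. \<exists>q\<in>stem y. q \<in> ball t d \<and> stem q \<inter> G n \<noteq> {}))"
    by (rule dependent_nat_choice[OF base step])
  then obtain G where G_step: "\<forall>n::nat. (open (G n) \<and> G n \<inter> X \<noteq> {} \<and> G n \<subseteq> ball e d) \<and>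
      (closure (G (Suc n)) \<subseteq> G n \<and>
      (\<forall>y\<in>G (Suc n) \<inter> X. \<exists>q\<in>stem y. q \<in> ball t d \<and> stem q \<inter> G n \<noteq> {}))"
    by (rule exE)
  have G: "G n \<inter> X \<noteq> {}" "G n \<subseteq> ball e d" "closure (G (Suc n)) \<subseteq> G n"
    "y \<in> G (Suc n) \<Longrightarrow> y \<in> X \<Longrightarrow> \<exists>q\<in>stem y. q \<in> ball t d \<and> stem q \<inter> G n \<noteq> {}" for n y
    using spec[OF G_step, of n] by simp_all
  have anti: "G n \<subseteq> G m" if "m \<le> n" for m n
    using that
  proof (induction n rule: dec_induct)
    case (step n)
    then show ?case using G(3)[of n] closure_subset[of "G (Suc n)"] by blast
  qed simp
  have "\<exists>v. v \<in> G n \<and> v \<in> X" for n using G(1)[of n] by auto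
  then obtain w where w: "\<And>n. w n \<in> G n" "\<And>n. w n \<in> X" by metis
  obtain y r where y: "y \<in> X" "strict_mono (r :: nat \<Rightarrow> nat)" "(w \<circ> r) \<longlonglongrightarrow> y"
    using compact_X w(2) unfolding compact_def by meson
  have yG: "y \<in> G n" for n
  proof -
    have "\<forall>\<^sub>F k in sequentially. (w \<circ> r) k \<in> closure (G (Suc n))"
    proof (rule eventually_sequentiallyI)
      fix k assume "Suc n \<le> k"
      then have "Suc n \<le> r k" using seq_suble[OF y(2), of k] by linarith
      then show "(w \<circ> r) k \<in> closure (G (Suc n))"
        using subsetD[OF anti w(1)] subsetD[OF closure_subset] unfolding comp_def by metis
    qed
    then have "y \<in> closure (G (Suc n))"
      using Lim_in_closed_set[OF closed_closure _ _ y(3)] by simp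
    then show ?thesis using G(3) by blast
  qed
  have "t \<notin> ball e d" using far[of t t] d by auto
  then have "y \<noteq> t" using yG[of 0] G(2)[of 0] by blast
  then obtain g where g: "arc g" "g ` {0..1} = stem y" "g 0 = t" "g 1 = y"
    "\<And>s. s \<in> {0..1} \<Longrightarrow> stem (g s) = g ` {0..s}"
    using stem_parametrization[OF y(1)] by metis
  have "uniformly_continuous_on {0..1} g"
    using g(1) by (simp add: arc_def path_def compact_uniformly_continuous)
  then obtain \<eta> where \<eta>: "\<eta> > 0"
    "\<And>a b. a \<in> {0..1} \<Longrightarrow> b \<in> {0..1} \<Longrightarrow> dist a b < \<eta> \<Longrightarrow> dist (g a) (g b) < d"
    unfolding uniformly_continuous_on_def using d by metis
  \<comment> \<open>Below a point of \<open>G n\<close> the stem makes \<open>n\<close> trips from \<open>ball e d\<close> to \<open>ball t d\<close>.\<close>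
  have climb: "real n * \<eta> \<le> s" if "s \<in> {0..1}" "g s \<in> G n" for n s
    using that
  proof (induction n arbitrary: s)
    case 0
    then show ?case by simp
  next
    case (Suc n)
    have "g s \<in> X" using Suc.prems(1) g(2) stem_subset[OF y(1)] by blast
    then obtain q where q: "q \<in> stem (g s)" "q \<in> ball t d" "stem q \<inter> G n \<noteq> {}"
      using G(4)[OF Suc.prems(2)] by blast
    obtain s1 where s1: "s1 \<in> {0..s}" "q = g s1"
      using q(1) g(5)[OF Suc.prems(1)] by auto
    have s1': "s1 \<in> {0..1}" using s1(1) Suc.prems(1) by simp
    obtain p where p: "p \<in> stem q" "p \<in> G n" using q(3) by blast
    obtain s2 where s2: "s2 \<in> {0..s1}" "p = g s2"
      using p(1) g(5)[OF s1'] s1(2) by auto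
    have s2': "s2 \<in> {0..1}" using s2(1) s1' by simp
    have "d \<le> dist (g s2) (g s1)"
      using far[of p q] p(2) G(2)[of n] q(2) s1(2) s2(2) by blast
    then have "\<not> dist s2 s1 < \<eta>" using \<eta>(2)[OF s2' s1'] by linarith
    then have "\<eta> \<le> s1 - s2" using s2(1) by (simp add: dist_real_def)
    moreover have "real n * \<eta> \<le> s2" using Suc.IH[OF s2'] p(2) s2(2) by simp
    ultimately show ?case using s1(1) by (simp add: algebra_simps)
  qed
  obtain n :: nat where "1 < real n * \<eta>" using reals_Archimedean3[OF \<eta>(1)] by blast
  moreover have "real n * \<eta> \<le> 1" using climb[of 1 n] yG[of n] g(4) by simp
  ultimately show False by linarith
qed

text \<open>A nondegenerate cluster is a continuum through the maximal point \<open>e\<close>, so it contains an inner point \<open>u\<close>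
of \<open>stem e\<close>. A homeomorphism moving \<open>u\<close> to another inner point moves \<open>e\<close> to the unique endpoint above that
point, so all stems of endpoints, up to their two ends, lie in the cluster of their tip; the ends are added
since clusters are closed and contain their base point.\<close>

lemma cluster_endpoint:
  assumes e: "e \<in> E"
  shows "cluster e = {e}"
proof (rule ccontr)
  assume ne: "cluster e \<noteq> {e}"
  have eX: "e \<in> X" "e \<noteq> t" using e endpoints_subset root_not_endpoint by auto
  note C = cluster_continuum[OF eX(1)]
  obtain y where y: "y \<in> cluster e" "y \<noteq> e" using ne C(2) by blast
  obtain U where U: "open U" "e \<in> U" "stem e \<inter> U \<subseteq> cluster e"
    by (rule stem_near_maximal_tip[OF eX(1) endpoint_maximal[OF e] C(1,3,2) y])
  obtain u where u: "u \<in> stem e" "u \<in> U" "u \<noteq> e" "u \<in> inner"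
    by (rule inner_near_tip[OF eX U(1,2)])
  have u_cl: "u \<in> cluster e" using U(3) u(1,2) by blast
  have inner_ret: "u' \<in> cluster e'" if e': "e' \<in> E" and u': "u' \<in> stem e'" "u' \<in> inner" for e' u'
  proof -
    obtain h k where h: "homeomorphism X X h k" "h u = u'"
      by (rule inner_homogeneous[OF u(4) u'(2)])
    note h0 = homeomorphism_root[OF h(1)]
    have he: "h e \<in> E" using homeomorphism_endpoint[OF h(1) eX(1)] e by blast
    have "u' \<in> stem (h e)" using homeomorphism_stem[OF h(1) h0 eX(1)] u(1) h(2) by blast
    then have "h e = e'" using endpoint_above_unique[OF he e' _ u'(1)] u'(2) by blast
    then show ?thesis using homeomorphism_cluster[OF h(1) h0 u_cl eX(1)] h(2) by simp
  qed
  have "u' \<in> cluster e'" if e': "e' \<in> E" and u': "u' \<in> stem e'" for e' u'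
  proof -
    have e'X: "e' \<in> X" "e' \<noteq> t" using e' endpoints_subset root_not_endpoint by auto
    have self: "e' \<in> cluster e'" by (rule cluster_continuum(2)[OF e'X(1)])
    have others: "w \<in> cluster e'" if "w \<in> stem e'" "w \<noteq> t" for w
      using inner_ret[OF e' that(1)] self inner_below[OF e'X(1) that(1) _ that(2)] by blast
    have "t \<in> cluster e'"
    proof (rule ccontr)
      assume "t \<notin> cluster e'"
      then have "open (- cluster e')" "t \<in> - cluster e'"
        using closed_cluster by auto
      moreover have "t islimpt stem e'"
        using connected_islimpt[OF connected_stem[OF e'X(1)] stem_ends[OF e'X(1)]] e'X(2) by metis
      ultimately obtain w where "w \<in> stem e'" "w \<in> - cluster e'" "w \<noteq> t"
        using islimptE by metis
      then show False using others by blast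
    qed
    then show ?thesis using others[OF u'] by blast
  qed
  then show False by (rule no_return)
qed

text \<open>A point \<open>y \<noteq> t\<close> with \<open>t\<close> in its cluster would be inner, and by homogeneity \<open>t\<close> would be in the
clusters of all inner points. As endpoints are limits of inner points, \<open>t\<close> would be in their clusters too.\<close>

lemma root_smooth: "smooth_at t"
  unfolding smooth_at_def
proof (intro ballI impI, rule ccontr)
  fix y assume y: "y \<in> X" "t \<in> cluster y" "y \<notin> stem t"
  then have yt: "y \<noteq> t" by simp
  have "y \<notin> E" using cluster_endpoint[of y] y(2) yt by auto
  then have y_inner: "y \<in> inner" using y(1) yt by blast
  have all: "t \<in> cluster z" if z: "z \<in> inner" for z
  proof -
    obtain h k where h: "homeomorphism X X h k" "h y = z"
      by (rule inner_homogeneous[OF y_inner z])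
    note h0 = homeomorphism_root[OF h(1)]
    show ?thesis using homeomorphism_cluster[OF h(1) h0 y(2,1)] h(2) h0 by simp
  qed
  obtain e where e: "e \<in> E" using exists_endpoint by blast
  then have eX: "e \<in> X" "e \<noteq> t" using endpoints_subset root_not_endpoint by auto
  have "t \<in> cluster e"
  proof (rule clusterI)
    fix U V assume U: "open U" "e \<in> U" and V: "open V" "t \<in> V"
    obtain z where z: "z \<in> stem e" "z \<in> U" "z \<noteq> e" "z \<in> inner"
      by (rule inner_near_tip[OF eX U])
    show "\<exists>x\<in>X. stem x \<inter> U \<noteq> {} \<and> x \<in> V"
      by (rule clusterD[OF all[OF z(4)] U(1) z(2) V]) blast
  qed
  then show False using cluster_endpoint[OF e] eX(2) by auto
qed

text \<open>Shadows have connected complements, and those of small neighbourhoods of \<open>e\<close> are small because the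
cluster of \<open>e\<close> is a single point.\<close>

lemma colocally_connected_at_endpoint:
  assumes e: "e \<in> E"
  shows "colocally_connected_at X e"
  unfolding colocally_connected_at_def
proof (intro allI impI)
  fix U assume "nbhd_in X e U"
  then obtain W where W: "open W" "e \<in> W" "X \<inter> W \<subseteq> U"
    unfolding nbhd_in_def openin_open by blast
  have eX: "e \<in> X" using e endpoints_subset by blast
  have "cluster e \<subseteq> W" using cluster_endpoint[OF e] W(2) by simp
  then obtain V where V: "open V" "e \<in> V" "shadow V \<subseteq> W"
    by (rule shadow_near_cluster[OF W(1)])
  obtain D where D: "open D" "shadow V = X \<inter> D" by (rule shadow_open[OF V(1)])
  then have "openin (top_of_set X) (shadow V)" by (simp add: openin_open_Int)
  moreover have "e \<in> shadow V" using shadow_superset[of V] eX V(2) by blast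
  ultimately have "nbhd_in X e (shadow V)"
    unfolding nbhd_in_def using shadow_subset[of V] by blast
  moreover have "shadow V \<subseteq> U" using V(3) W(3) shadow_subset[of V] by blast
  ultimately show "\<exists>V\<subseteq>U. nbhd_in X e V \<and> connected (X - V)"
    using connected_not_shadow by blast
qed

lemma subset_closure_endpoints: "X \<subseteq> closure E"
proof
  fix x assume x: "x \<in> X"
  show "x \<in> closure E"
  proof (rule ccontr)
    assume "x \<notin> closure E"
    then have "open (- closure E)" "(- closure E) \<inter> X \<noteq> {}" using x by auto
    then obtain e where "e \<in> E" "e \<in> - closure E" by (rule endpoints_dense)
    then show False using closure_subset[of E] by blast
  qed
qed

lemma smooth_points_eq: "smooth_points X t = E \<union> {t}"
proof -
  have "smooth_points X t = {a \<in> X. smooth_at a}"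
    unfolding smooth_points_def using smooth_wrt_iff by blast
  also have "\<dots> = E \<union> {t}"
    using endpoint_smooth root_smooth inner_not_smooth endpoints_subset root by blast
  finally show ?thesis .
qed

end


theorem theorem5p3:
  fixes X :: "'a::metric_space set" and t :: 'a
  assumes "fan_with_top X t"
    and "\<not> smooth X"
    and "inv_n_homogeneous 3 X"
  shows "(\<forall>p\<in>endpoints X. colocally_connected_at X p) \<and>
         X \<subseteq> closure (endpoints X) \<and>
         smooth_points X t = endpoints X \<union> {t}"
proof -
  have X: "dendroid X" "ramification_points X = {t}"
    using assms(1) unfolding fan_with_top_def by simp_all
  moreover have "t \<in> X"
    using X(2) unfolding ramification_points_def by blast
  ultimately interpret nonsmooth_three_orbit_fan X t
    using assms(2,3) by unfold_locales
  show ?thesis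
    using colocally_connected_at_endpoint subset_closure_endpoints smooth_points_eq by blast
qed

end
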